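(* Let $n\ge1$ be an integer, let $\lambda_{\mathrm p},\lambda_{\mathrm d},r_{\mathrm d}>0$, and let $\Phi$ be the $n$-dimensional Matérn cluster process with parameters $\lambda_{\mathrm p},\lambda_{\mathrm d},r_{\mathrm d}$. For an integer $k\ge1$ let $R_k$ be the $k$th contact distance of $\Phi$. Then for every $r>0$ the CDF of $R_k$ is $$F_{R_k}(r)=1-e^{h_0(r)-\lambda_{\mathrm p}v_n(r+r_{\mathrm d})^n}\sum_{m=0}^{k-1}\left[\sum_{(b_1,\dots,b_m)\in\mathsf B_m}\frac{(h_1(r))^{b_1}\cdots(h_m(r))^{b_m}}{b_1!\cdots b_m!}\right],$$ where the inner sum for $m=0$ equals $1$.
   Context: $\mathcal B(\boldsymbol x,r)$ is the ball in $\mathbb R^n$ with center $\boldsymbol x$ and radius $r$; $\mathrm o$ is the origin; $v_n=\pi^{n/2}/\Gamma(n/2+1)$ is the volume of the unit ball of $\mathbb R^n$. For $x\ge 0$, $\mathcal A(r,r_{\mathrm d},x)$ is the volume of $\mathcal B(\mathrm o,r)\cap\mathcal B(\boldsymbol x,r_{\mathrm d})$ for any $\boldsymbol x\in\mathbb R^n$ with $\|\boldsymbol x\|=x$. Matérn cluster process (MCP): let $\Phi_{\mathrm p}=\{\mathbf X_i\}$ be a homogeneous Poisson point process on $\mathbb R^n$ with intensity $\lambda_{\mathrm p}$ (parents). To each $\mathbf X_i$ attach a daughter process $\Phi_{\mathbf X_i}$, a Poisson point process with intensity function $\boldsymbol y\mapsto\lambda_{\mathrm d}\mathbf 1(\|\boldsymbol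 y\|\le r_{\mathrm d})$; the daughter processes are i.i.d. and independent of $\Phi_{\mathrm p}$. The MCP is $\Phi=\bigcup_{\mathbf X_i\in\Phi_{\mathrm p}}(\mathbf X_i+\Phi_{\mathbf X_i})$ (parents themselves are not included). The $k$th contact distance $R_k$ is the distance from the origin to the $k$th closest point of $\Phi$, so $F_{R_k}(r)=\mathbb P[R_k\le r]$ is the probability that $\mathcal B(\mathrm o,r)$ contains at least $k$ points of $\Phi$. For integers $j\ge0$, $$h_j(r)=\frac{\lambda_{\mathrm p}nv_n}{j!}\int_0^{r+r_{\mathrm d}}(\lambda_{\mathrm d}\mathcal A(r,r_{\mathrm d},x))^{j}e^{-\lambda_{\mathrm d}\mathcal A(r,r_{\mathrm d},x)}x^{n-1}\,\mathrm dx,$$ (in particular $h_0(r)=\lambda_{\mathrm p}nv_n\int_0^{r+r_{\mathrm d}}e^{-\lambda_{\mathrm d}\mathcal A(r,r_{\mathrm d},x)}x^{n-1}\,\mathrm dx$). $\mathsf B_m$ is the set of all $m$-tuples $(b_1,\dots,b_m)$ of nonnegative integers with $b_1+2b_2+\cdots+mb_m=m$. *)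

theory Defs
  imports "HOL-Probability.Probability"
begin

section \<open>Point processes\<close>

text \<open>A (simple) point process is a random locally finite subset of \<open>\<real>\<^sup>n\<close>, i.e. a measurable map
  into the space of locally finite configurations, whose sigma-algebra is generated by the numbers
  of points in bounded Borel sets.\<close>

definition configurations :: "(real^'n) set set" where
  "configurations = {N. \<forall>B. bounded B \<longrightarrow> finite (N \<inter> B)}"

definition config_space :: "(real^'n) set measure" where
  "config_space = sigma configurations
     {{N \<in> configurations. card (N \<inter> B) = m} | B m. B \<in> sets borel \<and> bounded B}"

text \<open>The Poisson law is written out because \<open>poisson_pmf\<close> is only specified for positive rates,
  whereas the mean may vanish here (in which case \<open>0 ^ 0 = 1\<close> gives the point mass at \<open>0\<close>).\<close>

definition (in prob_space) poisson_process ::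
    "(real^'n \<Rightarrow> real) \<Rightarrow> ('a \<Rightarrow> (real^'n) set) \<Rightarrow> bool" where
  "poisson_process f N \<longleftrightarrow>
     random_variable config_space N \<and>
     (\<forall>y. 0 \<le> f y) \<and>
     (\<forall>B\<in>sets borel. bounded B \<longrightarrow> set_integrable lborel B f) \<and>
     (\<forall>B\<in>sets borel. bounded B \<longrightarrow>
       (\<forall>m. \<P>(\<omega> in M. card (N \<omega> \<inter> B) = m) =
          (LINT y:B|lborel. f y) ^ m / fact m * exp (- (LINT y:B|lborel. f y)))) \<and>
     (\<forall>l (B :: nat \<Rightarrow> (real^'n) set).
        (\<forall>i<l. B i \<in> sets borel \<and> bounded (B i)) \<and> disjoint_family_on B {..<l} \<longrightarrow>
        indep_vars (\<lambda>_. count_space UNIV) (\<lambda>i \<omega>. card (N \<omega> \<inter> B i)) {..<l})"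

text \<open>The parents form a homogeneous Poisson process \<open>P\<close>, which is almost surely infinite because its
  intensity is positive. The random vectors \<open>X i\<close> enumerate \<open>P\<close> almost surely without repetition, and
  \<open>D i\<close> is the daughter process attached to the parent \<open>X i\<close>, centred at the origin. The \<open>D i\<close> are
  identically distributed, since the law of a Poisson process is determined by its intensity.
  Independence of the daughters from the parents is independence of the sequence \<open>D\<close> from the
  sequence \<open>X\<close>, so that the enumeration may not depend on the daughters either; it is stated for the
  generated sigma-algebras because \<open>indep_var\<close> needs both variables to have the same value type.\<close>

definition (in prob_space) matern_cluster_process ::
    "real \<Rightarrow> real \<Rightarrow> real \<Rightarrow> ('a \<Rightarrow> (real^'n) set) \<Rightarrow> bool" where
  "matern_cluster_process lp ld rd \<Phi> \<longleftrightarrow>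
     (\<exists>(P :: 'a \<Rightarrow> (real^'n) set) (X :: nat \<Rightarrow> 'a \<Rightarrow> real^'n) (D :: nat \<Rightarrow> 'a \<Rightarrow> (real^'n) set).
        poisson_process (\<lambda>_. lp) P \<and>
        (\<forall>i. random_variable borel (X i)) \<and>
        (AE \<omega> in M. bij_betw (\<lambda>i. X i \<omega>) UNIV (P \<omega>)) \<and>
        (\<forall>i. poisson_process (\<lambda>y. ld * indicator {y. norm y \<le> rd} y) (D i)) \<and>
        indep_vars (\<lambda>_. config_space) D UNIV \<and>
        indep_set
          (sets (vimage_algebra (space M) (\<lambda>\<omega> i. X i \<omega>) (PiM UNIV (\<lambda>_. borel))))
          (sets (vimage_algebra (space M) (\<lambda>\<omega> i. D i \<omega>) (PiM UNIV (\<lambda>_. config_space)))) \<and>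
        (\<forall>\<omega>\<in>space M. \<Phi> \<omega> = (\<Union>i. (\<lambda>y. X i \<omega> + y) ` D i \<omega>)))"

text \<open>Distance from the origin to the \<open>k\<close>-th closest point (\<open>k \<ge> 1\<close>), with value \<open>\<infinity>\<close> if there are
  fewer than \<open>k\<close> points.\<close>

definition contact_distance :: "nat \<Rightarrow> (real^'n) set \<Rightarrow> ereal" where
  "contact_distance k N =
     Inf {ereal s | s. 0 \<le> s \<and> (\<exists>S \<subseteq> N \<inter> cball 0 s. finite S \<and> card S = k)}"


section \<open>The quantities in the distribution function\<close>

text \<open>The type argument fixes the dimension. By rotation invariance of Lebesgue measure, the
  choice of the second centre does not matter; \<open>x \<ge> 0\<close> is intended.\<close>

definition ball_inter_volume :: "'n::finite itself \<Rightarrow> real \<Rightarrow> real \<Rightarrow> real \<Rightarrow> real" where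
  "ball_inter_volume _ r rd x =
     measure lborel (cball (0 :: real^'n) r \<inter> cball (SOME v. norm v = x) rd)"

definition h_fun :: "'n::finite itself \<Rightarrow> real \<Rightarrow> real \<Rightarrow> real \<Rightarrow> nat \<Rightarrow> real \<Rightarrow> real" where
  "h_fun T lp ld rd j r =
     lp * real CARD('n) * unit_ball_vol (real CARD('n)) / fact j *
       (LINT x:{0..r + rd}|lborel.
          (ld * ball_inter_volume T r rd x) ^ j * exp (- ld * ball_inter_volume T r rd x)
            * x ^ (CARD('n) - 1))"

text \<open>Tuples \<open>(b\<^sub>1, \<dots>, b\<^sub>m)\<close> are functions on \<open>{1..m}\<close>; for \<open>m = 0\<close> there is exactly one, the empty
  tuple.\<close>

definition B_tuples :: "nat \<Rightarrow> (nat \<Rightarrow> nat) set" where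
  "B_tuples m = {b \<in> {1..m} \<rightarrow>\<^sub>E UNIV. (\<Sum>i=1..m. i * b i) = m}"

lemma finite_B_tuples: "finite (B_tuples m)"
proof (rule finite_subset)
  show "B_tuples m \<subseteq> {1..m} \<rightarrow>\<^sub>E {..m}"
  proof
    fix b assume b: "b \<in> B_tuples m"
    have "b i \<le> m" if i: "i \<in> {1..m}" for i
    proof -
      have "b i \<le> i * b i" using i by simp
      also have "\<dots> \<le> (\<Sum>i=1..m. i * b i)"
        using i by (intro member_le_sum) auto
      finally show ?thesis using b by (simp add: B_tuples_def)
    qed
    with b show "b \<in> {1..m} \<rightarrow>\<^sub>E {..m}"
      by (auto simp: B_tuples_def PiE_iff)
  qed
qed (simp add: finite_PiE)

end

theory Submission
  imports Defs
begin

text \<open>Given the parents, the numbers of points that the clusters put into the ball of radius \<open>r\<close> are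
  independent Poisson variables with means \<open>\<lambda>\<^sub>d A(r, r\<^sub>d, \<parallel>X\<^sub>i\<parallel>)\<close>, and different clusters almost surely have
  no common point. Hence the total count has generating function \<open>E \<Prod>\<^sub>i exp (- (1 - s) \<lambda>\<^sub>d A(r, r\<^sub>d, \<parallel>X\<^sub>i\<parallel>))\<close>,
  which is a Laplace functional of the parent process and, in polar coordinates, equals
  \<open>exp (\<Sum>\<^sub>j h\<^sub>j(r) s\<^sup>j - \<lambda>\<^sub>p v\<^sub>n (r + r\<^sub>d)\<^sup>n)\<close>. The probabilities are read off from the coefficients of this power
  series: both they and the sums over \<open>B\<^sub>m\<close> satisfy the recursion \<open>m c\<^sub>m = \<Sum>\<^sub>j j h\<^sub>j c\<^sub>m\<^sub>-\<^sub>j\<close>.\<close>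

section \<open>Measurability of point counts\<close>

text \<open>The sigma-algebra of \<open>config_space\<close> only sees counts in fixed bounded Borel
  sets, whereas the argument counts daughters in balls shifted by random parents, compares two
  shifted clusters, and speaks of distances. Hence counts are shown to be jointly measurable in
  shift and configuration, and statements about individual points are rewritten as countable
  combinations of events that a grid cell is hit. The cluster process is locally finite only almost
  surely, so measurability of the contact distance event is obtained through grids, while its
  probability is computed from a measurable version of the count. Conditioning on the parents means
  Fubini for the product of the laws of the whole sequences \<open>X\<close> and \<open>D\<close>.
  The product over all parents is reached from finitely many clusters: only the finitely many
  parents within \<open>r + rd\<close> matter, so partial sums stabilise almost surely. The index
  from which they do so is random, and the limit is taken by dominated convergence with bound 1,
  which is why the generating functions are used for |s| at most 1.\<close>

lemma space_config_space [simp]: "space config_space = configurations"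
  by (auto simp: config_space_def intro!: space_measure_of)

lemma finite_configurationsD: "N \<in> configurations \<Longrightarrow> bounded B \<Longrightarrow> finite (N \<inter> B)"
  by (auto simp: configurations_def)

lemma measurable_card_config:
  assumes "B \<in> sets borel" "bounded B"
  shows "(\<lambda>N. card (N \<inter> B)) \<in> measurable config_space (count_space UNIV)"
proof (subst measurable_count_space_eq2_countable, intro conjI ballI)
  fix m :: nat
  have "(\<lambda>N. card (N \<inter> B)) -` {m} \<inter> space config_space = {N \<in> configurations. card (N \<inter> B) = m}"
    by auto
  moreover have "\<dots> \<in> sets config_space"
    unfolding config_space_def
    by (subst sets_measure_of) (use assms in \<open>auto intro!: sigma_sets.Basic\<close>)
  ultimately show "(\<lambda>N. card (N \<inter> B)) -` {m} \<inter> space config_space \<in> sets config_space" by simp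
qed auto

text \<open>Dynkin argument over \<open>A\<close>. On a rectangle the count splits into an indicator
  and a count in a fixed bounded set. The cut-off at \<open>R\<close> keeps every count finite, so
  that complements become differences and disjoint unions become series.\<close>

lemma measurable_card_section:
  fixes A :: "('a \<times> (real^'n)) set"
  assumes "A \<in> sets (L \<Otimes>\<^sub>M borel)"
  shows "(\<lambda>p. real (card {y \<in> snd p. norm y \<le> R \<and> (fst p, y) \<in> A}))
           \<in> borel_measurable (L \<Otimes>\<^sub>M config_space)"
proof -
  let ?f = "\<lambda>A p. real (card {y \<in> snd p. norm y \<le> R \<and> (fst p, y) \<in> A})"
  have fin: "finite {y \<in> N. norm y \<le> R \<and> Q y}" if "N \<in> configurations" for N :: "(real^'n) set" and Q
    by (rule finite_subset[OF _ finite_configurationsD[OF that bounded_cball[of 0 R]]]) auto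
  have meas: "(\<lambda>p. real (card (snd p \<inter> B))) \<in> borel_measurable (L \<Otimes>\<^sub>M config_space)"
    if "B \<in> sets borel" "bounded B" for B
  proof -
    have "(\<lambda>p. card (snd p \<inter> B)) \<in> (L \<Otimes>\<^sub>M config_space) \<rightarrow>\<^sub>M count_space UNIV"
      by (rule measurable_compose[OF measurable_snd measurable_card_config[OF that]])
    then show ?thesis by measurable
  qed
  show ?thesis
    using assms unfolding sets_pair_measure
  proof (induction rule: sigma_sets_induct_disjoint[OF Int_stable_pair_measure_generator pair_measure_closed, consumes 1, case_names basic empty compl union])
    case (basic A)
    then obtain a B where AB: "A = a \<times> B" "a \<in> sets L" "B \<in> sets borel" by auto
    have eq: "?f A = (\<lambda>p. indicator a (fst p) * real (card (snd p \<inter> (B \<inter> cball 0 R))))"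
    proof
      fix p
      show "?f A p = indicator a (fst p) * real (card (snd p \<inter> (B \<inter> cball 0 R)))"
      proof (cases "fst p \<in> a")
        case True
        then have "{y \<in> snd p. norm y \<le> R \<and> (fst p, y) \<in> A} = snd p \<inter> (B \<inter> cball 0 R)"
          using AB by auto
        then show ?thesis using True by simp
      qed (simp add: AB)
    qed
    have [measurable]: "a \<in> sets L" by fact
    have [measurable]: "(\<lambda>p. real (card (snd p \<inter> (B \<inter> cball 0 R)))) \<in> borel_measurable (L \<Otimes>\<^sub>M config_space)"
      by (rule meas) (use AB in auto)
    show ?case unfolding eq by measurable
  next
    case empty
    then show ?case by simp
  next
    case (compl A)
    have "A \<in> sets (L \<Otimes>\<^sub>M borel)" using compl(1) unfolding sets_pair_measure .
    from sets.sets_into_space[OF this] have sub: "A \<subseteq> space L \<times> space borel"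
      by (simp add: space_pair_measure)
    have "?f (space L \<times> space borel - A) p = ?f (space L \<times> space borel) p - ?f A p"
      if "p \<in> space (L \<Otimes>\<^sub>M config_space)" for p
    proof -
      have N: "snd p \<in> configurations" "fst p \<in> space L" using that by (auto simp: space_pair_measure)
      let ?S = "\<lambda>A. {y \<in> snd p. norm y \<le> R \<and> (fst p, y) \<in> A}"
      have "?S (space L \<times> space borel) = ?S (space L \<times> space borel - A) \<union> ?S A"
        using N sub by auto
      moreover have "?S (space L \<times> space borel - A) \<inter> ?S A = {}" by auto
      ultimately have "card (?S (space L \<times> space borel)) = card (?S (space L \<times> space borel - A)) + card (?S A)"
        by (simp only: card_Un_disjoint[OF fin[OF N(1)] fin[OF N(1)]])
      then show ?thesis by simp
    qed
    moreover have "(\<lambda>p. ?f (space L \<times> space borel) p - ?f A p) \<in> borel_measurable (L \<Otimes>\<^sub>M config_space)"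
    proof (rule borel_measurable_diff[OF _ compl(2)])
      have "?f (space L \<times> space borel) p = real (card (snd p \<inter> cball 0 R))"
        if "p \<in> space (L \<Otimes>\<^sub>M config_space)" for p
      proof -
        have "{y \<in> snd p. norm y \<le> R \<and> (fst p, y) \<in> space L \<times> space borel} = snd p \<inter> cball 0 R"
          using that by (auto simp: space_pair_measure)
        then show ?thesis by simp
      qed
      moreover have "(\<lambda>p. real (card (snd p \<inter> cball 0 R))) \<in> borel_measurable (L \<Otimes>\<^sub>M config_space)"
        by (rule meas) auto
      ultimately show "?f (space L \<times> space borel) \<in> borel_measurable (L \<Otimes>\<^sub>M config_space)"
        by (subst measurable_cong)
    qed
    ultimately show ?case by (subst measurable_cong)
  next
    case (union A)
    have "?f (\<Union>i. A i) p = (\<Sum>i. ?f (A i) p)"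
      if "p \<in> space (L \<Otimes>\<^sub>M config_space)" for p
    proof -
      have N: "snd p \<in> configurations" using that by (auto simp: space_pair_measure)
      let ?S = "\<lambda>A. {y \<in> snd p. norm y \<le> R \<and> (fst p, y) \<in> A}"
      have un: "?S (\<Union>i. A i) = (\<Union>i. ?S (A i))" by auto
      have dis: "disjoint_family (\<lambda>i. ?S (A i))"
        using union(1) by (auto simp: disjoint_family_on_def)
      \<comment> \<open>Each of the finitely many points within radius \<open>R\<close> lies in at
        most one of the disjoint sets \<open>A i\<close>, so the series is a finite sum.\<close>
      have finI: "finite {i. ?S (A i) \<noteq> {}}"
      proof (rule finite_subset)
        let ?g = "\<lambda>y. THE i. (fst p, y) \<in> A i"
        show "{i. ?S (A i) \<noteq> {}} \<subseteq> ?g ` {y \<in> snd p. norm y \<le> R \<and> True}"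
        proof
          fix i assume "i \<in> {i. ?S (A i) \<noteq> {}}"
          then obtain y where y: "y \<in> snd p" "norm y \<le> R" "(fst p, y) \<in> A i" by auto
          have "?g y = i" using y union(1) by (intro the_equality) (auto simp: disjoint_family_on_def)
          then show "i \<in> ?g ` {y \<in> snd p. norm y \<le> R \<and> True}" using y by auto
        qed
        show "finite (?g ` {y \<in> snd p. norm y \<le> R \<and> True})"
          by (rule finite_imageI[OF fin[OF N]])
      qed
      have "?S (\<Union>i. A i) = (\<Union>i\<in>{i. ?S (A i) \<noteq> {}}. ?S (A i))" by auto
      then have "card (?S (\<Union>i. A i)) = card (\<Union>i\<in>{i. ?S (A i) \<noteq> {}}. ?S (A i))" by simp
      also have "\<dots> = (\<Sum>i\<in>{i. ?S (A i) \<noteq> {}}. card (?S (A i)))"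
        by (rule card_UN_disjoint[OF finI]) (use fin[OF N] dis in \<open>auto simp: disjoint_family_on_def\<close>)
      finally have "?f (\<Union>i. A i) p = (\<Sum>i\<in>{i. ?S (A i) \<noteq> {}}. ?f (A i) p)" by simp
      also have "\<dots> = (\<Sum>i. ?f (A i) p)"
      proof (rule suminf_finite[symmetric, OF finI])
        fix i assume "i \<notin> {i. ?S (A i) \<noteq> {}}"
        then have "?S (A i) = {}" by blast
        then show "?f (A i) p = 0" by (simp only: card.empty of_nat_0)
      qed
      finally show ?thesis .
    qed
    moreover have "(\<lambda>p. \<Sum>i. ?f (A i) p) \<in> borel_measurable (L \<Otimes>\<^sub>M config_space)"
      by (rule borel_measurable_suminf) (rule union(3))
    ultimately show ?case by (subst measurable_cong)
  qed
qed

lemma measurable_nat_of_real: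
  fixes f :: "'a \<Rightarrow> nat"
  assumes "(\<lambda>x. real (f x)) \<in> borel_measurable M"
  shows "f \<in> measurable M (count_space UNIV)"
proof (subst measurable_count_space_eq2_countable, intro conjI ballI)
  fix m :: nat
  have "f -` {m} \<inter> space M = {x \<in> space M. real (f x) = real m}" by auto
  also have "\<dots> \<in> sets M" using assms by measurable
  finally show "f -` {m} \<inter> space M \<in> sets M" .
qed auto

text \<open>This makes it possible to count daughters in a ball seen from a random parent. As
  \<open>C\<close> is bounded, for each fixed shift the cut-off at \<open>R\<close> is eventually
  without effect, so the count is a pointwise limit of truncated counts.\<close>

lemma measurable_card_shift:
  fixes C :: "(real^'n) set"
  assumes C: "C \<in> sets borel" "bounded C"
  shows "(\<lambda>p. card (snd p \<inter> {y. fst p + y \<in> C}))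
           \<in> measurable (borel \<Otimes>\<^sub>M config_space) (count_space UNIV)"
proof (rule measurable_nat_of_real, rule borel_measurable_LIMSEQ_real)
  let ?A = "{p :: (real^'n) \<times> (real^'n). fst p + snd p \<in> C}"
  have "?A = (\<lambda>p. fst p + snd p) -` C \<inter> space (borel \<Otimes>\<^sub>M borel)"
    by (auto simp: space_pair_measure)
  also have "\<dots> \<in> sets (borel \<Otimes>\<^sub>M borel)"
    by (rule measurable_sets[OF _ C(1)]) measurable
  finally have A: "?A \<in> sets (borel \<Otimes>\<^sub>M borel)" .
  show "(\<lambda>p. real (card {y \<in> snd p. norm y \<le> real R \<and> (fst p, y) \<in> ?A}))
      \<in> borel_measurable (borel \<Otimes>\<^sub>M config_space)" for R
    by (rule measurable_card_section[OF A])
  obtain b where b: "\<And>x. x \<in> C \<Longrightarrow> norm x \<le> b" using C(2) unfolding bounded_iff by blast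
  fix p :: "(real^'n) \<times> (real^'n) set"
  have "eventually (\<lambda>R. real (card {y \<in> snd p. norm y \<le> real R \<and> (fst p, y) \<in> ?A})
           = real (card (snd p \<inter> {y. fst p + y \<in> C}))) sequentially"
  proof (rule eventually_sequentiallyI[of "nat \<lceil>norm (fst p) + b\<rceil>"])
    fix R assume "nat \<lceil>norm (fst p) + b\<rceil> \<le> R"
    then have R: "norm (fst p) + b \<le> real R" by linarith
    have "norm y \<le> real R" if "fst p + y \<in> C" for y
      using b[OF that] R norm_triangle_ineq4[of "fst p + y" "fst p"] by simp
    then have "{y \<in> snd p. norm y \<le> real R \<and> (fst p, y) \<in> ?A} = snd p \<inter> {y. fst p + y \<in> C}"
      by auto
    then show "real (card {y \<in> snd p. norm y \<le> real R \<and> (fst p, y) \<in> ?A})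
           = real (card (snd p \<inter> {y. fst p + y \<in> C}))" by simp
  qed
  then show "(\<lambda>R. real (card {y \<in> snd p. norm y \<le> real R \<and> (fst p, y) \<in> ?A}))
      \<longlonglongrightarrow> real (card (snd p \<inter> {y. fst p + y \<in> C}))"
    by (rule tendsto_eventually)
qed

section \<open>Contact distances\<close>

text \<open>Index of the half-open cube of side 1/m that contains \<open>y\<close>; for
  \<open>m = 0\<close> the whole space is one cell. The index type is countable, so uncountable
  quantifiers over points can be replaced by quantifiers over cells.\<close>

definition grid_index :: "nat \<Rightarrow> real^'n \<Rightarrow> int^'n" where
  "grid_index m y = (\<chi> i. \<lfloor>real m * y $ i\<rfloor>)"

lemma grid_cell_borel: "{y. grid_index m y = c} \<in> sets borel"
proof -
  have "{y. grid_index m y = c} =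
    (\<Inter>i. {y. real_of_int (c $ i) \<le> real m * y $ i} \<inter> {y. real m * y $ i < real_of_int (c $ i) + 1})"
    by (auto simp: grid_index_def vec_eq_iff floor_eq_iff)
  also have "\<dots> \<in> sets borel"
    by (intro sets.countable_INT'' sets.Int borel_closed borel_open closed_Collect_le open_Collect_less
        continuous_intros) auto
  finally show ?thesis .
qed

lemma eventually_grid_index_neq:
  assumes "x \<noteq> y"
  shows "eventually (\<lambda>m. grid_index m x \<noteq> grid_index m y) sequentially"
proof -
  from assms obtain i where i: "x $ i \<noteq> y $ i" by (auto simp: vec_eq_iff)
  define d where "d = \<bar>x $ i - y $ i\<bar>"
  have d: "d > 0" using i by (simp add: d_def)
  show ?thesis
  proof (rule eventually_sequentiallyI[of "nat \<lceil>1 / d\<rceil>"])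
    \<comment> \<open>For such \<open>m\<close> the scaled coordinates are at least 1 apart, which
      forces different floors.\<close>
    fix m assume "nat \<lceil>1 / d\<rceil> \<le> m"
    then have "1 / d \<le> real m" by linarith
    then have "1 \<le> real m * d" using d by (simp add: field_simps)
    also have "\<dots> = \<bar>real m * x $ i - real m * y $ i\<bar>"
      by (simp add: d_def abs_mult flip: right_diff_distrib)
    finally have "\<lfloor>real m * x $ i\<rfloor> \<noteq> \<lfloor>real m * y $ i\<rfloor>" by linarith
    then show "grid_index m x \<noteq> grid_index m y" by (auto simp: grid_index_def vec_eq_iff)
  qed
qed

lemma eventually_inj_on_grid_index:
  assumes "finite S"
  shows "eventually (\<lambda>m. inj_on (grid_index m) S) sequentially"
proof -
  have "eventually (\<lambda>m. \<forall>x\<in>S. \<forall>y\<in>S. x \<noteq> y \<longrightarrow> grid_index m x \<noteq> grid_index m y) sequentially"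
    using assms eventually_grid_index_neq
    by (intro eventually_ball_finite ballI) (auto intro: eventually_mono)
  then show ?thesis by (rule eventually_mono) (auto simp: inj_on_def)
qed

text \<open>A sufficiently fine grid separates finitely many points; conversely, one point chosen
  from each of \<open>k\<close> distinct cells that are hit gives \<open>k\<close> distinct
  points.\<close>

lemma card_subset_iff_grid:
  "(\<exists>S\<subseteq>T. finite S \<and> card S = k) \<longleftrightarrow>
   (\<exists>m. \<exists>C\<in>Collect finite. card C = k \<and> (\<forall>c\<in>C. \<exists>y\<in>T. grid_index m y = c))"
proof safe
  fix S assume S: "S \<subseteq> T" "finite S" "k = card S"
  from eventually_inj_on_grid_index[OF S(2)] obtain m where m: "inj_on (grid_index m) S"
    by (auto simp: eventually_sequentially)
  show "\<exists>m. \<exists>C\<in>Collect finite. card C = card S \<and> (\<forall>c\<in>C. \<exists>y\<in>T. grid_index m y = c)"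
    by (intro exI[of _ m] bexI[of _ "grid_index m ` S"]) (use m S in \<open>auto simp: card_image\<close>)
next
  fix m C assume C: "finite C" "\<forall>c\<in>C. \<exists>y\<in>T. grid_index m y = c"
  then obtain f where f: "\<And>c. c \<in> C \<Longrightarrow> f c \<in> T" "\<And>c. c \<in> C \<Longrightarrow> grid_index m (f c) = c"
    by metis
  have "inj_on f C" by (metis f(2) inj_onI)
  then show "\<exists>S\<subseteq>T. finite S \<and> card S = card C"
    by (intro exI[of _ "f ` C"]) (use f C in \<open>auto simp: card_image\<close>)
qed

text \<open>Reduces the event of having \<open>k\<close> points to hitting events of single cells,
  with \<open>T\<close> treated as an arbitrary random set rather than as a random element of
  \<open>config_space\<close>.\<close>

lemma sets_card_subset:
  fixes T :: "'a \<Rightarrow> (real^'n) set"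
  assumes "\<And>m c. {\<omega> \<in> space M. \<exists>y\<in>T \<omega>. grid_index m y = c} \<in> sets M"
  shows "{\<omega> \<in> space M. \<exists>S\<subseteq>T \<omega>. finite S \<and> card S = k} \<in> sets M"
  unfolding card_subset_iff_grid
proof (intro sets.sets_Collect_countable_Ex sets.sets_Collect_countable_Ex')
  show "countable (Collect finite :: (int^'n) set set)" by (rule countable_Collect_finite)
  fix m and C :: "(int^'n) set" assume "C \<in> Collect finite"
  show "{\<omega> \<in> space M. card C = k \<and> (\<forall>c\<in>C. \<exists>y\<in>T \<omega>. grid_index m y = c)} \<in> sets M"
    by (intro sets.sets_Collect_conj sets.sets_Collect_const sets.sets_Collect_countable_Ball assms)
qed

text \<open>For an arbitrary set \<open>N\<close> the infimum need not be attained, since points may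
  accumulate at the sphere from outside. Radii slightly above \<open>r\<close> avoid this, and a
  sequence of them keeps the condition countable.\<close>

lemma contact_distance_le_iff:
  assumes "r \<ge> 0"
  shows "contact_distance k N \<le> ereal r \<longleftrightarrow>
    (\<forall>j::nat. \<exists>S\<subseteq>N \<inter> cball 0 (r + inverse (real (Suc j))). finite S \<and> card S = k)"
proof
  assume le: "contact_distance k N \<le> ereal r"
  show "\<forall>j::nat. \<exists>S\<subseteq>N \<inter> cball 0 (r + inverse (real (Suc j))). finite S \<and> card S = k"
  proof
    fix j :: nat
    have "contact_distance k N < ereal (r + inverse (real (Suc j)))"
      using le by (rule le_less_trans) simp
    then obtain a where a: "a \<in> {ereal s | s. 0 \<le> s \<and> (\<exists>S\<subseteq>N \<inter> cball 0 s. finite S \<and> card S = k)}"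
        "a < ereal (r + inverse (real (Suc j)))"
      unfolding contact_distance_def Inf_less_iff by blast
    from a(1) obtain s where s': "a = ereal s" "\<exists>S\<subseteq>N \<inter> cball 0 s. finite S \<and> card S = k" by blast
    from a(2) s'(1) have "s < r + inverse (real (Suc j))" by (simp only: less_ereal.simps)
    then have "N \<inter> cball 0 s \<subseteq> N \<inter> cball 0 (r + inverse (real (Suc j)))"
      by (intro Int_mono subset_refl subset_cball) linarith
    with s'(2) show "\<exists>S\<subseteq>N \<inter> cball 0 (r + inverse (real (Suc j))). finite S \<and> card S = k"
      by (metis subset_trans)
  qed
next
  assume all: "\<forall>j::nat. \<exists>S\<subseteq>N \<inter> cball 0 (r + inverse (real (Suc j))). finite S \<and> card S = k"
  show "contact_distance k N \<le> ereal r"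
  proof (rule LIMSEQ_le_const)
    have "(\<lambda>j. r + inverse (real (Suc j))) \<longlonglongrightarrow> r + 0"
      by (intro tendsto_intros LIMSEQ_inverse_real_of_nat)
    then show "(\<lambda>j. ereal (r + inverse (real (Suc j)))) \<longlonglongrightarrow> ereal r" by simp
    have "contact_distance k N \<le> ereal (r + inverse (real (Suc j)))" for j
      unfolding contact_distance_def
      by (rule Inf_lower) (use all assms in \<open>auto intro!: exI[of _ "r + inverse (real (Suc j))"]\<close>)
    then show "\<exists>N'. \<forall>j\<ge>N'. contact_distance k N \<le> ereal (r + inverse (real (Suc j)))" by blast
  qed
qed

lemma contact_distance_le_iff_card:
  assumes "r \<ge> 0" and fin: "finite (N \<inter> cball 0 (r + 1))"
  shows "contact_distance k N \<le> ereal r \<longleftrightarrow> k \<le> card (N \<inter> cball 0 r)"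
proof -
  \<comment> \<open>Local finiteness enters here: the finitely many points of the shell between
    \<open>r\<close> and \<open>r + 1\<close> keep a positive distance from the ball of radius
    \<open>r\<close>, so some larger radius captures no new point.\<close>
  have "eventually (\<lambda>j. \<forall>y \<in> N \<inter> cball 0 (r + 1) - cball 0 r. r + inverse (real (Suc j)) < norm y) sequentially"
  proof (intro eventually_ball_finite ballI)
    fix y assume "y \<in> N \<inter> cball 0 (r + 1) - cball 0 r"
    then have "norm y > r + 0" by auto
    moreover have "(\<lambda>j. r + inverse (real (Suc j))) \<longlonglongrightarrow> r + 0"
      by (intro tendsto_intros LIMSEQ_inverse_real_of_nat)
    ultimately show "eventually (\<lambda>j. r + inverse (real (Suc j)) < norm y) sequentially"
      by (intro order_tendstoD(2))
  qed (use fin in auto)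
  then obtain j where j: "\<And>y. y \<in> N \<inter> cball 0 (r + 1) - cball 0 r \<Longrightarrow> r + inverse (real (Suc j)) < norm y"
    using eventually_happens'[OF sequentially_bot] by blast
  have le1: "inverse (real (Suc j)) \<le> 1" by (simp add: field_simps)
  have sub: "N \<inter> cball 0 (r + inverse (real (Suc j))) \<subseteq> N \<inter> cball 0 r"
    using j le1 by force
  have fin': "finite (N \<inter> cball 0 r)" by (rule finite_subset[OF _ fin]) auto
  show ?thesis
    unfolding contact_distance_le_iff[OF assms(1)]
  proof
    assume "\<forall>j::nat. \<exists>S\<subseteq>N \<inter> cball 0 (r + inverse (real (Suc j))). finite S \<and> card S = k"
    with sub obtain S where "S \<subseteq> N \<inter> cball 0 r" "card S = k" by (metis subset_trans)
    then show "k \<le> card (N \<inter> cball 0 r)" using card_mono[OF fin'] by blast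
  next
    assume "k \<le> card (N \<inter> cball 0 r)"
    then obtain S where S: "S \<subseteq> N \<inter> cball 0 r" "card S = k" "finite S"
      using obtain_subset_with_card_n by metis
    have "N \<inter> cball 0 r \<subseteq> N \<inter> cball 0 (r + inverse (real (Suc j)))" for j
      by (intro Int_mono subset_refl subset_cball) simp
    with S show "\<forall>j::nat. \<exists>S\<subseteq>N \<inter> cball 0 (r + inverse (real (Suc j))). finite S \<and> card S = k"
      by (metis subset_trans)
  qed
qed

section \<open>Poisson processes\<close>

context prob_space
begin

text \<open>For each outcome only the term \<open>m = Z \<omega>\<close> survives, and the absolute
  values of the integrated terms are dominated by the probabilities, whose series converges; this
  justifies integrating term by term.\<close>

lemma pgf_sums:
  fixes Z :: "'a \<Rightarrow> nat" and s :: real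
  assumes Z[measurable]: "Z \<in> measurable M (count_space UNIV)" and s: "\<bar>s\<bar> \<le> 1"
  shows "(\<lambda>m. prob {\<omega> \<in> space M. Z \<omega> = m} * s ^ m) sums expectation (\<lambda>\<omega>. s ^ Z \<omega>)"
proof -
  let ?f = "\<lambda>m \<omega>. indicator {\<omega> \<in> space M. Z \<omega> = m} \<omega> * s ^ m :: real"
  have int: "integrable M (?f m)" for m
    by (intro integrable_mult_left integrable_real_indicator) (auto simp: less_top[symmetric])
  have sg: "?f m \<omega> = (if m = Z \<omega> then s ^ m else 0)" if "\<omega> \<in> space M" for m \<omega>
    using that by (auto simp: indicator_def)
  have sums: "(\<lambda>m. ?f m \<omega>) sums s ^ Z \<omega>" if "\<omega> \<in> space M" for \<omega>
    using sums_single[of "Z \<omega>" "\<lambda>m. s ^ m"] by (simp add: sg[OF that])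
  have "(\<lambda>m. \<integral>\<omega>. ?f m \<omega> \<partial>M) sums (\<integral>\<omega>. (\<Sum>m. ?f m \<omega>) \<partial>M)"
  proof (rule sums_integral[OF int])
    show "AE \<omega> in M. summable (\<lambda>m. norm (?f m \<omega>))"
    proof (rule AE_I2)
      fix \<omega> assume w: "\<omega> \<in> space M"
      have "(\<lambda>m. norm (?f m \<omega>)) = (\<lambda>m. if m = Z \<omega> then \<bar>s\<bar> ^ m else 0)"
        unfolding sg[OF w] by (auto simp: fun_eq_iff power_abs)
      then show "summable (\<lambda>m. norm (?f m \<omega>))"
        using sums_summable[OF sums_single[of "Z \<omega>" "\<lambda>m. \<bar>s\<bar> ^ m"]] by simp
    qed
    show "summable (\<lambda>m. \<integral>\<omega>. norm (?f m \<omega>) \<partial>M)"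
    proof (rule summable_comparison_test')
      have "(\<lambda>m. measure M {\<omega> \<in> space M. Z \<omega> = m}) sums measure M (\<Union>m. {\<omega> \<in> space M. Z \<omega> = m})"
        by (rule finite_measure_UNION) (auto simp: disjoint_family_on_def)
      then show "summable (\<lambda>m. prob {\<omega> \<in> space M. Z \<omega> = m})" by (rule sums_summable)
      fix m :: nat
      have "(\<integral>\<omega>. norm (?f m \<omega>) \<partial>M) = prob {\<omega> \<in> space M. Z \<omega> = m} * \<bar>s\<bar> ^ m"
        by (simp add: abs_mult power_abs)
      also have "\<dots> \<le> prob {\<omega> \<in> space M. Z \<omega> = m} * 1"
        by (intro mult_left_mono power_le_one) (use s in auto)
      finally show "norm (\<integral>\<omega>. norm (?f m \<omega>) \<partial>M) \<le> prob {\<omega> \<in> space M. Z \<omega> = m}" by simp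
    qed
  qed
  moreover have "(\<integral>\<omega>. (\<Sum>m. ?f m \<omega>) \<partial>M) = expectation (\<lambda>\<omega>. s ^ Z \<omega>)"
    by (rule Bochner_Integration.integral_cong) (use sums in \<open>auto simp: sums_iff\<close>)
  ultimately show ?thesis by simp
qed

section \<open>Generating functions and the Laplace functional of a Poisson process\<close>

lemma poisson_process_measurable: "poisson_process f N \<Longrightarrow> random_variable config_space N"
  by (simp add: poisson_process_def)

lemma measurable_card_poisson:
  assumes "poisson_process f N" "B \<in> sets borel" "bounded B"
  shows "(\<lambda>\<omega>. card (N \<omega> \<inter> B)) \<in> measurable M (count_space UNIV)"
  using assms(1) unfolding poisson_process_def
  by (auto intro: measurable_compose[OF _ measurable_card_config[OF assms(2,3)]])

lemma expectation_power_card_poisson: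
  assumes N: "poisson_process f N" and B: "B \<in> sets borel" "bounded B" and s: "\<bar>s\<bar> \<le> 1"
  shows "expectation (\<lambda>\<omega>. s ^ card (N \<omega> \<inter> B)) = exp (- (1 - s) * (LINT y:B|lborel. f y))"
proof -
  let ?\<mu> = "LINT y:B|lborel. f y"
  have 1: "(\<lambda>m. prob {\<omega> \<in> space M. card (N \<omega> \<inter> B) = m} * s ^ m) sums expectation (\<lambda>\<omega>. s ^ card (N \<omega> \<inter> B))"
    by (rule pgf_sums[OF measurable_card_poisson[OF N B] s])
  have 2: "prob {\<omega> \<in> space M. card (N \<omega> \<inter> B) = m} * s ^ m = exp (- ?\<mu>) * ((?\<mu> * s) ^ m /\<^sub>R fact m)" for m
    using N B unfolding poisson_process_def by (simp add: power_mult_distrib divide_inverse)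
  have 3: "(\<lambda>m. exp (- ?\<mu>) * ((?\<mu> * s) ^ m /\<^sub>R fact m)) sums (exp (- ?\<mu>) * exp (?\<mu> * s))"
    by (intro sums_mult exp_converges)
  have "expectation (\<lambda>\<omega>. s ^ card (N \<omega> \<inter> B)) = exp (- ?\<mu>) * exp (?\<mu> * s)"
    by (rule sums_unique2[OF 1 3[folded 2]])
  then show ?thesis by (simp add: algebra_simps flip: exp_add)
qed

text \<open>With a separate argument \<open>s i\<close> for each set this is the Laplace functional
  of a step function, the starting point for general integrands.\<close>

lemma expectation_prod_power_card_poisson:
  fixes B :: "nat \<Rightarrow> (real^'n) set"
  assumes N: "poisson_process f N" and B: "\<And>i. i < l \<Longrightarrow> B i \<in> sets borel" "\<And>i. i < l \<Longrightarrow> bounded (B i)"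
    and dis: "disjoint_family_on B {..<l}" and s: "\<And>i. i < l \<Longrightarrow> \<bar>s i\<bar> \<le> 1"
  shows "expectation (\<lambda>\<omega>. \<Prod>i<l. s i ^ card (N \<omega> \<inter> B i)) =
    (\<Prod>i<l. exp (- (1 - s i) * (LINT y:B i|lborel. f y)))"
proof -
  have "indep_vars (\<lambda>_. count_space UNIV) (\<lambda>i \<omega>. card (N \<omega> \<inter> B i)) {..<l}"
    using N[unfolded poisson_process_def, THEN conjunct2, THEN conjunct2, THEN conjunct2, THEN conjunct2,
        rule_format, of l B] B dis by simp
  then have ind: "indep_vars (\<lambda>_. borel) (\<lambda>i \<omega>. s i ^ card (N \<omega> \<inter> B i)) {..<l}"
    by (rule indep_vars_compose2) simp
  have int: "integrable M (\<lambda>\<omega>. s i ^ card (N \<omega> \<inter> B i))" if "i < l" for i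
  proof (rule integrable_const_bound[where B = 1])
    show "AE \<omega> in M. norm (s i ^ card (N \<omega> \<inter> B i)) \<le> 1"
      using s[OF that] by (intro AE_I2) (auto simp: power_abs intro!: power_le_one)
    show "(\<lambda>\<omega>. s i ^ card (N \<omega> \<inter> B i)) \<in> borel_measurable M"
      by (rule measurable_compose[OF measurable_card_poisson[OF N B(1)[OF that] B(2)[OF that]]]) simp
  qed
  show ?thesis
    by (subst indep_vars_lebesgue_integral[OF _ ind])
       (auto simp: int B s expectation_power_card_poisson[OF N] intro!: prod.cong)
qed

text \<open>Rounding \<open>g\<close> down to multiples of 1/(m+1) gives step functions on
  \<open>A\<close>, for which the formula is a joint generating function of counts in disjoint level
  sets. Dominated convergence on both sides passes to \<open>g\<close>; the same pointwise limit
  gives measurability.\<close>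

lemma poisson_laplace_functional:
  fixes g :: "real^'n \<Rightarrow> real"
  assumes N: "poisson_process f N" and A: "A \<in> sets borel" "bounded A"
    and g[measurable]: "g \<in> borel_measurable borel"
    and g_bounds: "\<And>y. y \<in> A \<Longrightarrow> 0 \<le> g y" "\<And>y. y \<in> A \<Longrightarrow> g y \<le> real K"
  shows "expectation (\<lambda>\<omega>. exp (- (\<Sum>y\<in>N \<omega> \<inter> A. g y))) =
    exp (- (LINT y:A|lborel. (1 - exp (- g y)) * f y))"
    and "(\<lambda>\<omega>. exp (- (\<Sum>y\<in>N \<omega> \<inter> A. g y))) \<in> borel_measurable M"
proof -
  have [measurable]: "A \<in> sets borel" by fact
  have fint: "set_integrable lborel B f" if "B \<in> sets borel" "bounded B" for B
    using N that unfolding poisson_process_def by blast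
  have Nconf: "N \<omega> \<in> configurations" if "\<omega> \<in> space M" for \<omega>
    using N that unfolding poisson_process_def by (auto dest: measurable_space)
  \<comment> \<open>The bounds on \<open>g\<close> are only known on \<open>A\<close>;
    \<open>nat\<close> keeps \<open>q m\<close> nonnegative everywhere.\<close>
  define q where "q m y = real (nat \<lfloor>real (Suc m) * g y\<rfloor>) / real (Suc m)" for m y
  define B where "B m i = {y \<in> A. nat \<lfloor>real (Suc m) * g y\<rfloor> = i}" for m i
  \<comment> \<open>The rounded numerators run from 0 to (m+1)K inclusive, hence the outer
    \<open>Suc\<close>.\<close>
  define l where "l m = Suc (Suc m * K)" for m
  have B: "B m i \<in> sets borel" "bounded (B m i)" for m i
  proof -
    have "B m i = A \<inter> {y \<in> space borel. nat \<lfloor>real (Suc m) * g y\<rfloor> = i}" by (auto simp: B_def)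
    also have "\<dots> \<in> sets borel" by measurable
    finally show "B m i \<in> sets borel" .
    show "bounded (B m i)" by (rule bounded_subset[OF A(2)]) (auto simp: B_def)
  qed
  have dis: "disjoint_family_on (B m) I" for m I
    by (auto simp: disjoint_family_on_def B_def)
  have idx: "nat \<lfloor>real (Suc m) * g y\<rfloor> < l m" if "y \<in> A" for m y
  proof -
    have "real (Suc m) * g y \<le> real (Suc m * K)"
      unfolding of_nat_mult by (intro mult_left_mono g_bounds(2) that) simp
    then have "\<lfloor>real (Suc m) * g y\<rfloor> \<le> int (Suc m * K)" by linarith
    then show ?thesis unfolding l_def by linarith
  qed
  have q_lim: "(\<lambda>m. q m y) \<longlonglongrightarrow> g y" if y: "y \<in> A" for y
  proof (rule tendsto_sandwich[where f = "\<lambda>m. g y - inverse (real (Suc m))" and h = "\<lambda>_. g y"])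
    have e: "real_of_int \<lfloor>real (Suc m) * g y\<rfloor> = real (nat \<lfloor>real (Suc m) * g y\<rfloor>)" for m
      using g_bounds(1)[OF y] by simp
    have fl: "real (Suc m) * g y - 1 < real (nat \<lfloor>real (Suc m) * g y\<rfloor>)"
      "real (nat \<lfloor>real (Suc m) * g y\<rfloor>) \<le> real (Suc m) * g y" for m
      using real_of_int_floor_gt_diff_one[of "real (Suc m) * g y"] of_int_floor_le[of "real (Suc m) * g y"]
      unfolding e by blast+
    have "(real (Suc m) * g y - 1) / real (Suc m) \<le> q m y" "q m y \<le> real (Suc m) * g y / real (Suc m)" for m
      unfolding q_def by (intro divide_right_mono less_imp_le[OF fl(1)] fl(2); simp)+
    then have "g y - inverse (real (Suc m)) \<le> q m y" "q m y \<le> g y" for m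
      by (simp_all add: diff_divide_distrib inverse_eq_divide del: of_nat_Suc)
    then show "\<forall>\<^sub>F m in sequentially. g y - inverse (real (Suc m)) \<le> q m y"
      "\<forall>\<^sub>F m in sequentially. q m y \<le> g y" by (auto intro: always_eventually)
    have "(\<lambda>m. g y - inverse (real (Suc m))) \<longlonglongrightarrow> g y - 0"
      by (intro tendsto_intros LIMSEQ_inverse_real_of_nat)
    then show "(\<lambda>m. g y - inverse (real (Suc m))) \<longlonglongrightarrow> g y" by simp
  qed simp
  have q0: "0 \<le> q m y" for m y by (simp add: q_def)
  have qm[measurable]: "q m \<in> borel_measurable borel" for m unfolding q_def by measurable
  \<comment> \<open>Each point of the level set \<open>B m i\<close> contributes this factor to the
    exponential of the negative sum.\<close>
  define s where "s m i = exp (- (real i / real (Suc m)))" for m i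
  have s: "\<bar>s m i\<bar> \<le> 1" for m i by (simp add: s_def)
  have sum_q: "exp (- (\<Sum>y\<in>S. q m y)) = (\<Prod>i<l m. s m i ^ card (S \<inter> B m i))"
    if S: "finite S" "S \<subseteq> A" for S m
  proof -
    have "(\<Sum>y\<in>S. q m y) = (\<Sum>i<l m. \<Sum>y | y \<in> S \<and> nat \<lfloor>real (Suc m) * g y\<rfloor> = i. q m y)"
      by (rule sum.group[symmetric]) (use S idx in auto)
    also have "\<dots> = (\<Sum>i<l m. real (card (S \<inter> B m i)) * (real i / real (Suc m)))"
    proof (rule sum.cong[OF refl])
      fix i
      have eq: "{y. y \<in> S \<and> nat \<lfloor>real (Suc m) * g y\<rfloor> = i} = S \<inter> B m i"
        using S by (auto simp: B_def)
      have "(\<Sum>y\<in>S \<inter> B m i. q m y) = (\<Sum>y\<in>S \<inter> B m i. real i / real (Suc m))"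
        by (rule sum.cong) (auto simp: q_def B_def)
      then show "(\<Sum>y | y \<in> S \<and> nat \<lfloor>real (Suc m) * g y\<rfloor> = i. q m y) = real (card (S \<inter> B m i)) * (real i / real (Suc m))"
        unfolding eq by simp
    qed
    finally show ?thesis by (simp add: s_def exp_sum sum_negf[symmetric] exp_of_nat_mult[symmetric])
  qed
  have set_q: "(LINT y:A|lborel. (1 - exp (- q m y)) * f y) = (\<Sum>i<l m. (1 - s m i) * (LINT y:B m i|lborel. f y))" for m
  proof -
    have "(LINT y:A|lborel. (1 - exp (- q m y)) * f y) =
      (LINT y|lborel. (\<Sum>i<l m. (1 - s m i) * (indicator (B m i) y *\<^sub>R f y)))"
      unfolding set_lebesgue_integral_def
    proof (rule Bochner_Integration.integral_cong[OF refl])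
      fix y :: "real^'n"
      show "indicator A y *\<^sub>R ((1 - exp (- q m y)) * f y) = (\<Sum>i<l m. (1 - s m i) * (indicator (B m i) y *\<^sub>R f y))"
      proof (cases "y \<in> A")
        case True
        let ?i = "nat \<lfloor>real (Suc m) * g y\<rfloor>"
        have "(\<Sum>i<l m. (1 - s m i) * (indicator (B m i) y *\<^sub>R f y)) = (\<Sum>i<l m. if i = ?i then (1 - s m ?i) * f y else 0)"
          by (rule sum.cong) (use True in \<open>auto simp: B_def\<close>)
        also have "\<dots> = (1 - s m ?i) * f y" using idx[OF True] by (simp add: sum.delta)
        finally show ?thesis using True by (simp add: s_def q_def)
      qed (simp add: B_def)
    qed
    also have "\<dots> = (\<Sum>i<l m. (1 - s m i) * (LINT y:B m i|lborel. f y))"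
      unfolding set_lebesgue_integral_def
      by (subst Bochner_Integration.integral_sum)
         (use fint[OF B] in \<open>auto simp: set_integrable_def\<close>)
    finally show ?thesis .
  qed
  have E: "expectation (\<lambda>\<omega>. exp (- (\<Sum>y\<in>N \<omega> \<inter> A. q m y))) =
      exp (- (LINT y:A|lborel. (1 - exp (- q m y)) * f y))" for m
  proof -
    have "expectation (\<lambda>\<omega>. exp (- (\<Sum>y\<in>N \<omega> \<inter> A. q m y))) = expectation (\<lambda>\<omega>. \<Prod>i<l m. s m i ^ card (N \<omega> \<inter> B m i))"
    proof (rule Bochner_Integration.integral_cong[OF refl])
      fix \<omega> assume "\<omega> \<in> space M"
      then have "finite (N \<omega> \<inter> A)" by (intro finite_configurationsD Nconf A(2))
      moreover have "N \<omega> \<inter> A \<inter> B m i = N \<omega> \<inter> B m i" for i by (auto simp: B_def)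
      ultimately show "exp (- (\<Sum>y\<in>N \<omega> \<inter> A. q m y)) = (\<Prod>i<l m. s m i ^ card (N \<omega> \<inter> B m i))"
        using sum_q[of "N \<omega> \<inter> A" m] by simp
    qed
    also have "\<dots> = (\<Prod>i<l m. exp (- (1 - s m i) * (LINT y:B m i|lborel. f y)))"
      by (rule expectation_prod_power_card_poisson[OF N B dis s])
    also have "\<dots> = exp (- (LINT y:A|lborel. (1 - exp (- q m y)) * f y))"
      unfolding set_q by (simp only: sum_negf[symmetric] exp_sum[OF finite_lessThan] mult_minus_left)
    finally show ?thesis .
  qed
  have meas: "(\<lambda>\<omega>. exp (- (\<Sum>y\<in>N \<omega> \<inter> A. q m y))) \<in> borel_measurable M" for m
  proof -
    have [measurable]: "(\<lambda>\<omega>. card (N \<omega> \<inter> B m i)) \<in> measurable M (count_space UNIV)" for i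
      by (rule measurable_card_poisson[OF N B])
    have "(\<lambda>\<omega>. \<Prod>i<l m. s m i ^ card (N \<omega> \<inter> B m i)) \<in> borel_measurable M" by measurable
    also have "?this \<longleftrightarrow> ?thesis"
    proof (rule measurable_cong)
      fix \<omega> assume "\<omega> \<in> space M"
      then have "finite (N \<omega> \<inter> A)" by (intro finite_configurationsD Nconf A(2))
      moreover have "N \<omega> \<inter> A \<inter> B m i = N \<omega> \<inter> B m i" for i by (auto simp: B_def)
      ultimately show "(\<Prod>i<l m. s m i ^ card (N \<omega> \<inter> B m i)) = exp (- (\<Sum>y\<in>N \<omega> \<inter> A. q m y))"
        using sum_q[of "N \<omega> \<inter> A" m] by simp
    qed
    finally show ?thesis .
  qed
  have lim: "(\<lambda>m. exp (- (\<Sum>y\<in>N \<omega> \<inter> A. q m y))) \<longlonglongrightarrow> exp (- (\<Sum>y\<in>N \<omega> \<inter> A. g y))" for \<omega>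
    by (intro tendsto_intros q_lim) auto
  show meas_lim: "(\<lambda>\<omega>. exp (- (\<Sum>y\<in>N \<omega> \<inter> A. g y))) \<in> borel_measurable M"
    by (rule borel_measurable_LIMSEQ_real[OF lim meas])
  have "(\<lambda>m. expectation (\<lambda>\<omega>. exp (- (\<Sum>y\<in>N \<omega> \<inter> A. q m y)))) \<longlonglongrightarrow> expectation (\<lambda>\<omega>. exp (- (\<Sum>y\<in>N \<omega> \<inter> A. g y)))"
    by (rule integral_dominated_convergence[where w = "\<lambda>_. 1"])
       (use lim meas meas_lim in \<open>auto simp: sum_nonneg q0\<close>)
  moreover have "(\<lambda>m. exp (- (LINT y:A|lborel. (1 - exp (- q m y)) * f y))) \<longlonglongrightarrow>
      exp (- (LINT y:A|lborel. (1 - exp (- g y)) * f y))"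
    unfolding set_lebesgue_integral_def
  proof (intro tendsto_intros integral_dominated_convergence[where w = "\<lambda>y. norm (indicator A y *\<^sub>R f y)"])
    have fm: "(\<lambda>y. indicator A y *\<^sub>R f y) \<in> borel_measurable lborel"
      using fint[OF A] unfolding set_integrable_def by (rule borel_measurable_integrable)
    have eq: "(\<lambda>y. indicator A y *\<^sub>R ((1 - exp (- u y)) * f y)) = (\<lambda>y. (1 - exp (- u y)) * (indicator A y *\<^sub>R f y))" for u
      by (auto simp: fun_eq_iff)
    show "(\<lambda>y. indicator A y *\<^sub>R ((1 - exp (- g y)) * f y)) \<in> borel_measurable lborel"
      unfolding eq by (intro borel_measurable_times fm) measurable
    show "(\<lambda>y. indicator A y *\<^sub>R ((1 - exp (- q m y)) * f y)) \<in> borel_measurable lborel" for m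
      unfolding eq by (intro borel_measurable_times fm) measurable
    show "integrable lborel (\<lambda>y. norm (indicator A y *\<^sub>R f y))"
      using fint[OF A] unfolding set_integrable_def by (rule integrable_norm)
    show "AE y in lborel. (\<lambda>m. indicator A y *\<^sub>R ((1 - exp (- q m y)) * f y)) \<longlonglongrightarrow>
        indicator A y *\<^sub>R ((1 - exp (- g y)) * f y)"
    proof (rule AE_I2)
      fix y show "(\<lambda>m. indicator A y *\<^sub>R ((1 - exp (- q m y)) * f y)) \<longlonglongrightarrow>
        indicator A y *\<^sub>R ((1 - exp (- g y)) * f y)"
        by (cases "y \<in> A") (auto intro!: tendsto_intros q_lim)
    qed
    show "AE y in lborel. norm (indicator A y *\<^sub>R ((1 - exp (- q m y)) * f y)) \<le> norm (indicator A y *\<^sub>R f y)" for m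
      using q0[of m] by (intro AE_I2) (auto simp: abs_mult indicator_def intro!: mult_left_le_one_le)
  qed
  ultimately show "expectation (\<lambda>\<omega>. exp (- (\<Sum>y\<in>N \<omega> \<inter> A. g y))) =
    exp (- (LINT y:A|lborel. (1 - exp (- g y)) * f y))"
    unfolding E by (rule LIMSEQ_unique)
qed

end

section \<open>Independent point processes\<close>

context prob_space
begin

text \<open>Rectangles determine the product of two sigma-finite measures, and on rectangles the
  joint law factors by independence. The conclusion, an equation of measures, is the form of
  independence on which Fubini acts.\<close>

lemma distr_pair_indep_set:
  assumes X[measurable]: "X \<in> measurable M S" and Y[measurable]: "Y \<in> measurable M T"
    and indep: "indep_set (sets (vimage_algebra (space M) X S)) (sets (vimage_algebra (space M) Y T))"
  shows "distr M S X \<Otimes>\<^sub>M distr M T Y = distr M (S \<Otimes>\<^sub>M T) (\<lambda>\<omega>. (X \<omega>, Y \<omega>))"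
proof (rule pair_measure_eqI)
  show "sigma_finite_measure (distr M S X)" "sigma_finite_measure (distr M T Y)"
    by (simp_all add: prob_space_distr prob_space_imp_sigma_finite)
  fix A B assume "A \<in> sets (distr M S X)" "B \<in> sets (distr M T Y)"
  then have A[measurable]: "A \<in> sets S" and B[measurable]: "B \<in> sets T" by auto
  have "emeasure (distr M (S \<Otimes>\<^sub>M T) (\<lambda>\<omega>. (X \<omega>, Y \<omega>))) (A \<times> B) =
      emeasure M ((X -` A \<inter> space M) \<inter> (Y -` B \<inter> space M))"
    by (subst emeasure_distr) (auto intro!: arg_cong[where f = "emeasure M"])
  also have "\<dots> = emeasure M (X -` A \<inter> space M) * emeasure M (Y -` B \<inter> space M)"
    unfolding emeasure_eq_measure
    by (subst indep_setD[OF indep in_vimage_algebra[OF A] in_vimage_algebra[OF B]]) (simp add: ennreal_mult)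
  finally show "emeasure (distr M S X) A * emeasure (distr M T Y) B =
      emeasure (distr M (S \<Otimes>\<^sub>M T) (\<lambda>\<omega>. (X \<omega>, Y \<omega>))) (A \<times> B)"
    by (simp add: emeasure_distr)
qed simp

text \<open>This is conditioning on \<open>X\<close>: the value of \<open>X\<close> is frozen while
  \<open>Y\<close> is averaged over an independent copy \<open>\<omega>'\<close> of the
  randomness.\<close>

lemma expectation_independent_pair:
  fixes f :: "'b \<times> 'c \<Rightarrow> real"
  assumes X[measurable]: "X \<in> measurable M S" and Y[measurable]: "Y \<in> measurable M T"
    and indep: "distr M S X \<Otimes>\<^sub>M distr M T Y = distr M (S \<Otimes>\<^sub>M T) (\<lambda>\<omega>. (X \<omega>, Y \<omega>))"
    and f[measurable]: "f \<in> borel_measurable (S \<Otimes>\<^sub>M T)" and bound: "\<And>z. \<bar>f z\<bar> \<le> C"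
  shows "expectation (\<lambda>\<omega>. f (X \<omega>, Y \<omega>)) = expectation (\<lambda>\<omega>. expectation (\<lambda>\<omega>'. f (X \<omega>, Y \<omega>')))"
proof -
  interpret DX: prob_space "distr M S X" by (rule prob_space_distr) simp
  interpret DY: prob_space "distr M T Y" by (rule prob_space_distr) simp
  interpret pair_prob_space "distr M S X" "distr M T Y" ..
  have int: "integrable (distr M S X \<Otimes>\<^sub>M distr M T Y) f"
    by (rule P.integrable_const_bound[where B = C]) (use bound in auto)
  have "(\<integral>\<omega>. f (X \<omega>, Y \<omega>) \<partial>M) = integral\<^sup>L (distr M (S \<Otimes>\<^sub>M T) (\<lambda>\<omega>. (X \<omega>, Y \<omega>))) f"
    by (subst integral_distr) auto
  also have "\<dots> = (\<integral>x. (\<integral>y. f (x, y) \<partial>distr M T Y) \<partial>distr M S X)"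
    unfolding indep[symmetric] by (rule integral_fst'[OF int, symmetric])
  also have "\<dots> = (\<integral>\<omega>. (\<integral>y. f (X \<omega>, y) \<partial>distr M T Y) \<partial>M)"
    by (subst integral_distr) (auto intro!: DY.borel_measurable_lebesgue_integral)
  also have "\<dots> = (\<integral>\<omega>. (\<integral>\<omega>'. f (X \<omega>, Y \<omega>') \<partial>M) \<partial>M)"
  proof (rule Bochner_Integration.integral_cong[OF refl])
    fix \<omega> assume "\<omega> \<in> space M"
    then have "X \<omega> \<in> space S" by (rule measurable_space[OF X])
    then show "(\<integral>y. f (X \<omega>, y) \<partial>distr M T Y) = (\<integral>\<omega>'. f (X \<omega>, Y \<omega>') \<partial>M)"
      by (subst integral_distr) (auto intro!: measurable_compose[OF measurable_Pair1' f])
  qed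
  finally show ?thesis .
qed

text \<open>The null-set counterpart of conditioning: by Fubini, sections that are null for every
  frozen value of \<open>X\<close> make the exceptional set null.\<close>

lemma AE_independent_pair:
  assumes X[measurable]: "X \<in> measurable M S" and Y[measurable]: "Y \<in> measurable M T"
    and indep: "distr M S X \<Otimes>\<^sub>M distr M T Y = distr M (S \<Otimes>\<^sub>M T) (\<lambda>\<omega>. (X \<omega>, Y \<omega>))"
    and Q[measurable]: "Measurable.pred (S \<Otimes>\<^sub>M T) Q"
    and AE: "\<And>x. x \<in> space S \<Longrightarrow> AE \<omega> in M. Q (x, Y \<omega>)"
  shows "AE \<omega> in M. Q (X \<omega>, Y \<omega>)"
proof -
  interpret DX: prob_space "distr M S X" by (rule prob_space_distr) simp
  interpret DY: prob_space "distr M T Y" by (rule prob_space_distr) simp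
  interpret pair_prob_space "distr M S X" "distr M T Y" ..
  have "AE z in distr M S X \<Otimes>\<^sub>M distr M T Y. Q z"
  proof (rule AE_pair_measure)
    show "{z \<in> space (distr M S X \<Otimes>\<^sub>M distr M T Y). Q z} \<in> sets (distr M S X \<Otimes>\<^sub>M distr M T Y)"
      by measurable
    show "AE x in distr M S X. AE y in distr M T Y. Q (x, y)"
    proof (rule AE_I2)
      fix x assume "x \<in> space (distr M S X)"
      then have x: "x \<in> space S" by simp
      have "{y \<in> space T. Q (x, y)} \<in> sets T"
        using x by measurable
      then show "AE y in distr M T Y. Q (x, y)"
        by (subst AE_distr_iff[OF Y]) (use AE[OF x] in auto)
    qed
  qed
  then have "AE z in distr M (S \<Otimes>\<^sub>M T) (\<lambda>\<omega>. (X \<omega>, Y \<omega>)). Q z" by (simp only: indep)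
  then show ?thesis by (subst (asm) AE_distr_iff) auto
qed

text \<open>A point has Lebesgue measure 0, so its count is Poisson with mean 0, and the convention
  that 0 to the power 0 is 1 gives the value 0 probability 1.\<close>

lemma AE_point_notin_poisson:
  fixes N :: "'a \<Rightarrow> (real^'n) set"
  assumes N: "poisson_process f N"
  shows "AE \<omega> in M. p \<notin> N \<omega>"
proof -
  have B: "{p} \<in> sets borel" "bounded {p}" by auto
  have "(LINT y:{p}|lborel. f y) = 0"
  proof -
    have "AE y in lborel. y \<noteq> p" using AE_lborel_singleton[of p] by auto
    then have "AE y in lborel. indicator {p} y *\<^sub>R f y = 0" by eventually_elim auto
    then show ?thesis unfolding set_lebesgue_integral_def by (rule integral_eq_zero_AE)
  qed
  moreover have "prob {\<omega> \<in> space M. card (N \<omega> \<inter> {p}) = 0} =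
      (LINT y:{p}|lborel. f y) ^ 0 / fact 0 * exp (- (LINT y:{p}|lborel. f y))"
    using N B unfolding poisson_process_def by blast
  ultimately have "prob {\<omega> \<in> space M. card (N \<omega> \<inter> {p}) = 0} = 1" by simp
  then have "AE \<omega> in M. card (N \<omega> \<inter> {p}) = 0" by (rule AE_prob_1[THEN AE_mp]) auto
  then show ?thesis by eventually_elim auto
qed

text \<open>Counts are prescribed for bounded sets only, so the complement of \<open>A\<close> is
  exhausted by its intersections with balls of integer radius, each having mean 0.\<close>

lemma AE_poisson_empty:
  fixes N :: "'a \<Rightarrow> (real^'n) set"
  assumes N: "poisson_process f N" and f0: "\<And>y. y \<notin> A \<Longrightarrow> f y = 0" and A: "A \<in> sets borel"
  shows "AE \<omega> in M. N \<omega> \<subseteq> A"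
proof -
  have "AE \<omega> in M. \<forall>R::nat. card (N \<omega> \<inter> (cball 0 (real R) - A)) = 0"
    unfolding AE_all_countable
  proof
    fix R :: nat
    let ?B = "cball 0 (real R) - A"
    have B: "?B \<in> sets borel" "bounded ?B" using A by (auto intro: bounded_subset[OF bounded_cball])
    have "(LINT y:?B|lborel. f y) = (LINT y|(lborel :: (real^'n) measure). 0)"
      unfolding set_lebesgue_integral_def
      by (rule Bochner_Integration.integral_cong) (use f0 in \<open>auto simp: indicator_def\<close>)
    moreover have "prob {\<omega> \<in> space M. card (N \<omega> \<inter> ?B) = 0} =
        (LINT y:?B|lborel. f y) ^ 0 / fact 0 * exp (- (LINT y:?B|lborel. f y))"
      using N B unfolding poisson_process_def by blast
    ultimately have "prob {\<omega> \<in> space M. card (N \<omega> \<inter> ?B) = 0} = 1" by simp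
    then show "AE \<omega> in M. card (N \<omega> \<inter> ?B) = 0" by (rule AE_prob_1[THEN AE_mp]) auto
  qed
  moreover have "AE \<omega> in M. N \<omega> \<in> configurations"
    using measurable_space[OF poisson_process_measurable[OF N]] by (intro AE_I2) simp
  ultimately show ?thesis
  proof eventually_elim
    case (elim \<omega>)
    show ?case
    proof
      fix y assume y: "y \<in> N \<omega>"
      obtain R :: nat where R: "norm y \<le> real R" using real_arch_simple by blast
      \<comment> \<open>\<open>card\<close> is 0 for infinite sets as well; only local finiteness
        turns a zero count into emptiness.\<close>
      have "finite (N \<omega> \<inter> (cball 0 (real R) - A))"
        by (rule finite_configurationsD[OF elim(2)]) (auto intro: bounded_subset[OF bounded_cball])
      then have "N \<omega> \<inter> (cball 0 (real R) - A) = {}"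
        using elim(1)[rule_format, of R] by (simp only: card_0_eq)
      then show "y \<in> A" using y R by auto
    qed
  qed
qed

end

text \<open>For locally finite configurations a hit is the same as a nonzero count, because a
  translate of a bounded set is bounded and \<open>card\<close> cannot vanish through
  infinity.\<close>

lemma measurable_shift_hits:
  fixes C :: "(real^'n) set"
  assumes C: "C \<in> sets borel" "bounded C"
  shows "Measurable.pred (borel \<Otimes>\<^sub>M config_space) (\<lambda>p. \<exists>y\<in>snd p. fst p + y \<in> C)"
proof -
  have [measurable]: "(\<lambda>p. card (snd p \<inter> {y. fst p + y \<in> C})) \<in> measurable (borel \<Otimes>\<^sub>M config_space) (count_space UNIV)"
    by (rule measurable_card_shift[OF C])
  have "Measurable.pred (borel \<Otimes>\<^sub>M config_space) (\<lambda>p. card (snd p \<inter> {y. fst p + y \<in> C}) \<noteq> 0)"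
    by measurable
  also have "?this \<longleftrightarrow> ?thesis"
  proof (rule measurable_cong)
    fix p :: "(real^'n) \<times> (real^'n) set" assume "p \<in> space (borel \<Otimes>\<^sub>M config_space)"
    then have N: "snd p \<in> configurations" by (auto simp: space_pair_measure)
    have "bounded ((\<lambda>z. - fst p + z) ` C)" by (rule bounded_translation[OF C(2)])
    also have "(\<lambda>z. - fst p + z) ` C = {y. fst p + y \<in> C}"
      by (auto simp: image_iff intro!: bexI[of _ "fst p + _"])
    finally have "finite (snd p \<inter> {y. fst p + y \<in> C})" by (rule finite_configurationsD[OF N])
    then show "(card (snd p \<inter> {y. fst p + y \<in> C}) \<noteq> 0) = (\<exists>y\<in>snd p. fst p + y \<in> C)" by auto
  qed
  finally show ?thesis .
qed

text \<open>Two locally finite sets are disjoint iff inside every ball of integer radius some grid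
  has no cell hit by both: a fine grid separates all the finitely many points in the ball, while a
  common point lies in a common cell of every grid.\<close>

lemma measurable_shifts_disjoint:
  "Measurable.pred ((borel \<Otimes>\<^sub>M config_space) \<Otimes>\<^sub>M (borel \<Otimes>\<^sub>M config_space))
     (\<lambda>z. \<forall>y\<in>snd (fst z). \<forall>y'\<in>snd (snd z). fst (fst z) + y \<noteq> fst (snd z) + (y' :: real^'n))"
proof -
  let ?C = "\<lambda>R m c. cball 0 (real R) \<inter> {y. grid_index m y = c} :: (real^'n) set"
  let ?H = "\<lambda>R m c p. \<exists>y\<in>snd p. fst p + y \<in> ?C R m c"
  have C: "?C R m c \<in> sets borel" "bounded (?C R m c)" for R :: nat and m c
    by (intro sets.Int grid_cell_borel borel_closed closed_cball) (auto intro: bounded_subset[OF bounded_cball])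
  have [measurable]: "Measurable.pred (borel \<Otimes>\<^sub>M config_space) (?H R m c)" for R m c
    by (rule measurable_shift_hits[OF C])
  have "Measurable.pred ((borel \<Otimes>\<^sub>M config_space) \<Otimes>\<^sub>M (borel \<Otimes>\<^sub>M config_space))
    (\<lambda>z. \<forall>R::nat. \<exists>m. \<forall>c::int^'n. \<not> (?H R m c (fst z) \<and> ?H R m c (snd z)))"
    by measurable
  also have "?this \<longleftrightarrow> ?thesis"
  proof (rule measurable_cong)
    fix z :: "((real^'n) \<times> (real^'n) set) \<times> ((real^'n) \<times> (real^'n) set)"
    assume z: "z \<in> space ((borel \<Otimes>\<^sub>M config_space) \<Otimes>\<^sub>M (borel \<Otimes>\<^sub>M config_space))"
    obtain x N x' N' where zz: "z = ((x, N), (x', N'))" by (metis prod.exhaust)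
    have N: "N \<in> configurations" "N' \<in> configurations" using z by (auto simp: space_pair_measure zz)
    have fin: "finite {v. (\<exists>y\<in>S. v = u + y) \<and> norm v \<le> real R}" if S: "S \<in> configurations"
      for u :: "real^'n" and S R
    proof -
      have "{v. (\<exists>y\<in>S. v = u + y) \<and> norm v \<le> real R} \<subseteq> (\<lambda>y. u + y) ` (S \<inter> cball (- u) (real R))"
        by (auto simp: dist_norm image_iff algebra_simps norm_minus_commute)
      then show ?thesis
        by (rule finite_subset) (intro finite_imageI finite_configurationsD[OF S] bounded_cball)
    qed
    show "(\<forall>R::nat. \<exists>m. \<forall>c::int^'n. \<not> (?H R m c (fst z) \<and> ?H R m c (snd z))) \<longleftrightarrow>
      (\<forall>y\<in>snd (fst z). \<forall>y'\<in>snd (snd z). fst (fst z) + y \<noteq> fst (snd z) + y')"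
    proof safe
      fix y y' assume *: "\<forall>R::nat. \<exists>m. \<forall>c::int^'n. \<not> (?H R m c (fst z) \<and> ?H R m c (snd z))"
        "y \<in> snd (fst z)" "y' \<in> snd (snd z)" "fst (fst z) + y = fst (snd z) + y'"
      obtain R :: nat where R: "norm (fst (fst z) + y) \<le> real R" using real_arch_simple by blast
      from *(1) obtain m where m: "\<And>c::int^'n. \<not> (?H R m c (fst z) \<and> ?H R m c (snd z))" by blast
      have "?H R m (grid_index m (fst (fst z) + y)) (fst z)"
        by (rule bexI[OF _ *(2)]) (use R in simp)
      moreover have "?H R m (grid_index m (fst (fst z) + y)) (snd z)"
        by (rule bexI[OF _ *(3)]) (use R *(4) in simp)
      ultimately show False using m by blast
    next
      fix R :: nat
      assume *: "\<forall>y\<in>snd (fst z). \<forall>y'\<in>snd (snd z). fst (fst z) + y \<noteq> fst (snd z) + y'"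
      let ?S = "{v. (\<exists>y\<in>N. v = x + y) \<and> norm v \<le> real R} \<union> {v. (\<exists>y\<in>N'. v = x' + y) \<and> norm v \<le> real R}"
      have "finite ?S" using fin N by blast
      from eventually_happens'[OF sequentially_bot eventually_inj_on_grid_index[OF this]]
      obtain m where m: "inj_on (grid_index m) ?S" by blast
      have "\<not> (?H R m c (fst z) \<and> ?H R m c (snd z))" for c
      proof
        assume "?H R m c (fst z) \<and> ?H R m c (snd z)"
        then obtain y y' where yy: "y \<in> N" "y' \<in> N'" "x + y \<in> ?C R m c" "x' + y' \<in> ?C R m c"
          by (auto simp: zz)
        have "x + y = x' + y'"
          by (rule inj_onD[OF m]) (use yy in auto)
        then show False using * yy by (auto simp: zz)
      qed
      then show "\<exists>m. \<forall>c::int^'n. \<not> (?H R m c (fst z) \<and> ?H R m c (snd z))" by blast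
    qed
  qed
  finally show ?thesis .
qed

section \<open>Polar coordinates\<close>

text \<open>The library states the invariance of Lebesgue measure under orthogonal maps only for well-ordered
  index types. In general it follows from the uniqueness of translation-invariant measures: Fubini's theorem
  applied to \<open>g (f x) h (f x + y)\<close> turns \<open>\<integral> g \<circ> f \<cdot> \<integral> h\<close> into \<open>\<integral> g \<cdot> \<integral> h \<circ> f\<close>, and the indicator
  \<open>g\<close> of the unit ball satisfies \<open>g \<circ> f = g\<close>.\<close>

lemma distr_lborel_orthogonal_transformation:
  fixes f :: "'a::euclidean_space \<Rightarrow> 'a"
  assumes f: "orthogonal_transformation f"
  shows "distr lborel borel f = lborel"
proof (rule measure_eqI)
  fix A assume "A \<in> sets (distr lborel borel f)"
  then have A: "A \<in> sets borel" by simp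
  have lin: "linear f" by (rule orthogonal_transformation_linear[OF f])
  have [measurable]: "f \<in> borel_measurable borel"
    by (intro borel_measurable_continuous_onI linear_continuous_on linear_conv_bounded_linear[THEN iffD1] lin)
  define g :: "'a \<Rightarrow> ennreal" where "g = indicator (cball 0 1)"
  define h :: "'a \<Rightarrow> ennreal" where "h = indicator A"
  have [measurable]: "g \<in> borel_measurable borel" "h \<in> borel_measurable borel"
    using A by (simp_all add: g_def h_def borel_measurable_indicator)
  have shift: "(\<integral>\<^sup>+y. u (c + y) \<partial>lborel) = (\<integral>\<^sup>+y. u y \<partial>lborel)"
    if [measurable]: "u \<in> borel_measurable borel" for u :: "'a \<Rightarrow> ennreal" and c
    by (subst (2) lborel_distr_plus[of c, symmetric], subst nn_integral_distr) auto
  have gf: "g (f x) = g x" and g_minus: "g (x - y) = g (- x + y)" for x y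
    by (simp_all add: g_def indicator_def orthogonal_transformation_norm[OF f] norm_minus_commute)
  have int_h: "(\<integral>\<^sup>+y. h y \<partial>lborel) = emeasure lborel A" using A by (simp add: h_def)
  have int_hf: "(\<integral>\<^sup>+x. h (f x) \<partial>lborel) = emeasure (distr lborel borel f) A"
  proof -
    have "(\<integral>\<^sup>+x. h (f x) \<partial>lborel) = (\<integral>\<^sup>+x. h x \<partial>distr lborel borel f)"
      by (subst nn_integral_distr) auto
    then show ?thesis using A by (simp add: h_def)
  qed
  let ?G = "\<integral>\<^sup>+x. g x \<partial>lborel"
  have "?G * emeasure lborel A = (\<integral>\<^sup>+x. g (f x) * (\<integral>\<^sup>+y. h (f x + y) \<partial>lborel) \<partial>lborel)"
    by (simp add: shift gf nn_integral_multc int_h)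
  also have "\<dots> = (\<integral>\<^sup>+x. (\<integral>\<^sup>+y. g (f x) * h (f x + y) \<partial>lborel) \<partial>lborel)"
    by (simp add: nn_integral_cmult)
  also have "\<dots> = (\<integral>\<^sup>+y. (\<integral>\<^sup>+x. g (f x) * h (f x + y) \<partial>lborel) \<partial>lborel)"
    by (rule lborel_pair.Fubini') measurable
  also have "\<dots> = (\<integral>\<^sup>+y. (\<integral>\<^sup>+x. g (f x - y) * h (f x) \<partial>lborel) \<partial>lborel)"
  proof (rule nn_integral_cong)
    fix y
    \<comment> \<open>Surjectivity moves the shift by \<open>y\<close> inside \<open>f\<close>:
      translating \<open>x\<close> by a preimage of \<open>y\<close> turns one integrand into the
      other, and the integral is translation invariant.\<close>
    obtain z where z: "f z = y" using orthogonal_transformation_surj[OF f] by (metis surjD)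
    have "(\<integral>\<^sup>+x. g (f x - y) * h (f x) \<partial>lborel) = (\<integral>\<^sup>+x. g (f (z + x) - y) * h (f (z + x)) \<partial>lborel)"
      by (rule shift[symmetric]) measurable
    then show "(\<integral>\<^sup>+x. g (f x) * h (f x + y) \<partial>lborel) = (\<integral>\<^sup>+x. g (f x - y) * h (f x) \<partial>lborel)"
      by (simp add: linear_add[OF lin] z add.commute)
  qed
  also have "\<dots> = (\<integral>\<^sup>+x. (\<integral>\<^sup>+y. g (f x - y) * h (f x) \<partial>lborel) \<partial>lborel)"
    by (rule lborel_pair.Fubini') measurable
  also have "\<dots> = (\<integral>\<^sup>+x. ?G * h (f x) \<partial>lborel)"
  proof (rule nn_integral_cong)
    fix x
    show "(\<integral>\<^sup>+y. g (f x - y) * h (f x) \<partial>lborel) = ?G * h (f x)"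
      unfolding g_minus[of "f x"] by (subst nn_integral_multc, measurable) (subst shift, auto)
  qed
  also have "\<dots> = ?G * emeasure (distr lborel borel f) A"
    by (simp add: nn_integral_cmult int_hf)
  finally have eq: "?G * emeasure lborel A = ?G * emeasure (distr lborel borel f) A" .
  have G: "?G = emeasure lborel (cball (0 :: 'a) 1)" by (simp add: g_def)
  have "?G \<noteq> 0" "?G \<noteq> \<top>"
    unfolding G using content_cball_pos[of 1 "0 :: 'a"] emeasure_lborel_cball_finite[of "0 :: 'a" 1]
    by (auto simp: measure_def)
  then show "emeasure (distr lborel borel f) A = emeasure lborel A"
    using eq by (simp add: ennreal_mult_cancel_left)
qed simp

section \<open>Volumes of intersections of balls and integrals of radial functions\<close>

lemma measure_cball_Int_cball_cong:
  fixes u v :: "real^'n"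
  assumes "norm u = norm v"
  shows "measure lborel (cball 0 r \<inter> cball u s) = measure lborel (cball 0 r \<inter> cball v s)"
proof -
  from assms obtain f where f: "orthogonal_transformation f" "f u = v"
    by (metis orthogonal_transformation_exists)
  have [measurable]: "f \<in> borel_measurable borel"
    by (intro borel_measurable_continuous_onI linear_continuous_on linear_conv_bounded_linear[THEN iffD1]
        orthogonal_transformation_linear f(1))
  have "measure lborel (cball 0 r \<inter> cball v s) = measure (distr lborel borel f) (cball 0 r \<inter> cball v s)"
    by (simp add: distr_lborel_orthogonal_transformation[OF f(1)])
  also have "\<dots> = measure lborel (f -` (cball 0 r \<inter> cball v s))"
    by (subst measure_distr) (auto intro!: sets.Int)
  also have "f -` (cball 0 r \<inter> cball v s) = cball 0 r \<inter> cball u s"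
    using f by (auto simp: orthogonal_transformation_isometry orthogonal_transformation_norm[OF f(1)])
  finally show ?thesis by simp
qed

text \<open>The vector \<open>v\<close> witnesses that the centre picked by the choice operator
  really has norm \<open>x\<close>; a rotation then exchanges the two centres.\<close>

lemma ball_inter_volume_eq:
  fixes v :: "real^'n"
  assumes "norm v = x"
  shows "ball_inter_volume TYPE('n) r rd x = measure lborel (cball 0 r \<inter> cball v rd)"
proof -
  have "norm (SOME u :: real^'n. norm u = x) = x" by (rule someI[of _ v]) (rule assms)
  with assms show ?thesis
    unfolding ball_inter_volume_def by (intro measure_cball_Int_cball_cong) simp
qed

text \<open>Polar coordinates for radial integrands need no surface measure: the image under
  \<open>norm\<close> of Lebesgue measure on the ball and the measure with density n v t^(n-1) on
  [0, R] have the same distribution function, v min(x, R)^n for x at least 0, where v is the volume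
  of the unit ball.\<close>

lemma integral_cball_norm:
  fixes \<phi> :: "real \<Rightarrow> real"
  assumes \<phi>[measurable]: "\<phi> \<in> borel_measurable borel" and R: "R \<ge> 0"
  shows "(LINT x:cball (0 :: real^'n) R|lborel. \<phi> (norm x)) =
    real CARD('n) * unit_ball_vol (real CARD('n)) * (LINT t:{0..R}|lborel. \<phi> t * t ^ (CARD('n) - 1))"
proof -
  let ?n = "CARD('n)" and ?v = "unit_ball_vol (real CARD('n))"
  define w where "w t = real ?n * ?v * t ^ (?n - 1)" for t :: real
  define \<mu> where "\<mu> = distr (density lborel (indicator (cball (0 :: real^'n) R))) borel norm"
  define \<nu> where "\<nu> = density lborel (\<lambda>t. ennreal (indicator {0..R} t * w t))"
  have [measurable]: "(indicator (cball (0 :: real^'n) R) :: _ \<Rightarrow> ennreal) \<in> borel_measurable borel"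
    by (intro borel_measurable_indicator) auto
  have n0: "?n > 0" by simp
  have \<mu>: "emeasure \<mu> {..x} = ennreal (if x < 0 then 0 else ?v * min x R ^ ?n)" for x
  proof -
    have "emeasure \<mu> {..x} = emeasure lborel (cball (0 :: real^'n) R \<inter> {y. norm y \<le> x})"
      unfolding \<mu>_def
      by (subst emeasure_distr, simp, simp, subst emeasure_density)
         (auto simp: nn_integral_indicator[symmetric] indicator_inter_arith vimage_def
               intro!: nn_integral_cong split: split_indicator)
    also have "\<dots> = ennreal (if x < 0 then 0 else ?v * min x R ^ ?n)"
    proof (cases "x < 0")
      case True
      then have "{y :: real^'n. norm y \<le> x} = {}" by (auto simp: not_le intro: less_le_trans)
      then show ?thesis using True by simp
    next
      case False
      then have "cball (0 :: real^'n) R \<inter> {y. norm y \<le> x} = cball 0 (min x R)" by auto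
      then show ?thesis using False R by (simp add: emeasure_cball)
    qed
    finally show ?thesis .
  qed
  have \<nu>: "emeasure \<nu> {..x} = ennreal (if x < 0 then 0 else ?v * min x R ^ ?n)" for x
  proof -
    have "emeasure \<nu> {..x} = (\<integral>\<^sup>+t. ennreal (w t) * indicator {0..min x R} t \<partial>lborel)"
      unfolding \<nu>_def by (subst emeasure_density) (auto simp: w_def intro!: nn_integral_cong split: split_indicator)
    also have "\<dots> = ennreal (if x < 0 then 0 else ?v * min x R ^ ?n)"
    proof (cases "x < 0")
      case False
      have "(\<integral>\<^sup>+t. ennreal (w t) * indicator {0..min x R} t \<partial>lborel) = ennreal (?v * min x R ^ ?n - ?v * 0 ^ ?n)"
      proof (rule nn_integral_FTC_Icc)
        fix t assume t: "t \<in> {0..min x R}"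
        show "((\<lambda>t. ?v * t ^ ?n) has_real_derivative w t) (at t)"
          unfolding w_def by (auto intro!: derivative_eq_intros)
        show "0 \<le> w t" using t by (simp add: w_def)
      qed (use False R in \<open>auto simp: w_def\<close>)
      then show ?thesis using False n0 by (simp add: power_0_left)
    qed simp
    finally show ?thesis .
  qed
  have "\<mu> = \<nu>"
  proof (rule cdf_unique')
    have fin: "emeasure \<rho> UNIV < \<infinity>" if "\<And>x. emeasure \<rho> {..x} = ennreal (if x < 0 then 0 else ?v * min x R ^ ?n)"
      "sets \<rho> = sets borel" for \<rho> :: "real measure"
    proof -
      have "emeasure \<rho> (\<Union>i::nat. {..real i}) = (SUP i. emeasure \<rho> {..real i})"
        by (rule SUP_emeasure_incseq[symmetric]) (auto simp: that(2) incseq_def)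
      also have "\<dots> \<le> ennreal (?v * R ^ ?n)"
        unfolding that(1) by (rule SUP_least) (use R in \<open>auto intro!: ennreal_leI mult_left_mono power_mono\<close>)
      also have "(\<Union>i::nat. {..real i}) = UNIV" using real_arch_simple by auto
      finally show ?thesis by (simp add: le_less_trans)
    qed
    have borel: "sets \<mu> = sets borel" "sets \<nu> = sets borel" by (simp_all add: \<mu>_def \<nu>_def)
    have fbm: "finite_borel_measure \<rho>" if "emeasure \<rho> UNIV < \<infinity>" "sets \<rho> = sets borel" for \<rho> :: "real measure"
      using that sets_eq_imp_space_eq[OF that(2)]
      by (intro finite_borel_measure.intro finite_measureI finite_borel_measure_axioms.intro) (simp_all add: less_top)
    show "finite_borel_measure \<mu>" by (rule fbm[OF fin[OF \<mu> borel(1)] borel(1)])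
    show "finite_borel_measure \<nu>" by (rule fbm[OF fin[OF \<nu> borel(2)] borel(2)])
    show "cdf \<mu> = cdf \<nu>" by (simp add: fun_eq_iff cdf_def measure_def \<mu> \<nu>)
  qed
  have [measurable]: "(indicator (cball (0 :: real^'n) R) :: _ \<Rightarrow> real) \<in> borel_measurable borel"
    by (intro borel_measurable_indicator) auto
  have "(\<integral>t. \<phi> t \<partial>\<mu>) =
      (\<integral>x. \<phi> (norm x) \<partial>density lborel (\<lambda>x. ennreal (indicator (cball (0 :: real^'n) R) x)))"
    unfolding \<mu>_def ennreal_indicator by (rule integral_distr) simp_all
  also have "\<dots> = (LINT x:cball (0 :: real^'n) R|lborel. \<phi> (norm x))"
    unfolding set_lebesgue_integral_def by (rule integral_density) auto
  finally have "(LINT x:cball (0 :: real^'n) R|lborel. \<phi> (norm x)) = (\<integral>t. \<phi> t \<partial>\<mu>)" by simp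
  also have "\<dots> = (LINT t|lborel. (indicator {0..R} t * w t) *\<^sub>R \<phi> t)"
    unfolding \<open>\<mu> = \<nu>\<close> \<nu>_def by (subst integral_density) (auto simp: w_def split: split_indicator)
  also have "\<dots> = (LINT t|lborel. (real ?n * ?v) * (indicator {0..R} t *\<^sub>R (\<phi> t * t ^ (?n - 1))))"
    by (rule Bochner_Integration.integral_cong) (auto simp: w_def)
  also have "\<dots> = real ?n * ?v * (LINT t:{0..R}|lborel. \<phi> t * t ^ (?n - 1))"
    unfolding set_lebesgue_integral_def by (rule integral_mult_right_zero)
  finally show ?thesis .
qed

text \<open>The intersections are the sections of one closed subset of the product space, and the
  measure of a section depends measurably on the base point.\<close>

lemma borel_measurable_cball_Int_cball:
  "(\<lambda>x :: real^'n. measure lborel (cball 0 r \<inter> cball x s)) \<in> borel_measurable borel"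
proof -
  let ?Q = "{p :: (real^'n) \<times> (real^'n). norm (snd p) \<le> r \<and> dist (fst p) (snd p) \<le> s}"
  have "closed ?Q"
    unfolding Collect_conj_eq by (intro closed_Int closed_Collect_le continuous_intros)
  then have "?Q \<in> sets (borel \<Otimes>\<^sub>M borel)"
    unfolding borel_prod by (rule borel_closed)
  also have "sets (borel \<Otimes>\<^sub>M borel) = sets (borel \<Otimes>\<^sub>M (lborel :: (real^'n) measure))"
    by (intro sets_pair_measure_cong) simp_all
  finally have "?Q \<in> sets (borel \<Otimes>\<^sub>M lborel)" .
  then have "(\<lambda>x. emeasure lborel (Pair x -` ?Q)) \<in> borel_measurable borel"
    by (rule lborel.measurable_emeasure_Pair)
  also have "(\<lambda>x. Pair x -` ?Q) = (\<lambda>x. cball 0 r \<inter> cball x s)" by auto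
  finally show ?thesis unfolding measure_def by measurable
qed

section \<open>Coefficients of exponentials of power series\<close>

text \<open>Once all lower coefficients vanish, the series may be divided by s^m; the quotient is
  zero for s different from 0 and tends to \<open>d m\<close> at 0.\<close>

lemma powser_sums_0_imp_coeff_0:
  fixes d :: "nat \<Rightarrow> real"
  assumes "\<And>s. \<bar>s\<bar> < 1 \<Longrightarrow> (\<lambda>m. d m * s ^ m) sums 0"
  shows "d m = 0"
proof (induction m rule: less_induct)
  case (less m)
  have "((\<lambda>_. 0) \<longlongrightarrow> d (0 + m)) (at (0 :: real))"
  proof (rule powser_limit_0_strong[where s = 1 and a = "\<lambda>j. d (j + m)"])
    fix s :: real assume s: "s \<noteq> 0" "norm s < 1"
    have "(\<lambda>j. d (j + m) * s ^ (j + m)) sums (0 - (\<Sum>j<m. d j * s ^ j))"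
      by (rule sums_split_initial_segment) (use assms s in simp)
    then have "(\<lambda>j. d (j + m) * s ^ (j + m)) sums 0" using less by simp
    then have "(\<lambda>j. d (j + m) * s ^ (j + m) / s ^ m) sums (0 / s ^ m)" by (rule sums_divide)
    then show "(\<lambda>j. d (j + m) * s ^ j) sums 0" using s by (simp add: power_add)
  qed simp
  then show ?case using tendsto_unique[OF _ tendsto_const[of 0 "at (0::real)"]] by simp
qed

lemma fps_eqI_unit_disc:
  fixes F G :: "real fps"
  assumes F: "fps_conv_radius F \<ge> 1" and G: "fps_conv_radius G \<ge> 1"
    and eq: "\<And>s. \<bar>s\<bar> < 1 \<Longrightarrow> eval_fps F s = eval_fps G s"
  shows "F = G"
proof (rule fps_ext)
  fix m
  have "fps_nth F m - fps_nth G m = 0"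
  proof (rule powser_sums_0_imp_coeff_0[where d = "\<lambda>m. fps_nth F m - fps_nth G m"])
    fix s :: real assume s: "\<bar>s\<bar> < 1"
    then have "ereal (norm s) < 1" by simp
    from less_le_trans[OF this F] less_le_trans[OF this G]
    have "ereal (norm s) < fps_conv_radius F" "ereal (norm s) < fps_conv_radius G" .
    then have "(\<lambda>m. fps_nth F m * s ^ m) sums eval_fps F s" "(\<lambda>m. fps_nth G m * s ^ m) sums eval_fps G s"
      by (auto intro!: sums_eval_fps)
    from sums_diff[OF this] show "(\<lambda>m. (fps_nth F m - fps_nth G m) * s ^ m) sums 0"
      by (simp add: eq[OF s] left_diff_distrib)
  qed
  then show "fps_nth F m = fps_nth G m" by simp
qed

text \<open>Differentiating F = exp (H - c) gives F' = H' F. Both sides are power series converging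
  on the open unit disc, so the identity may be read coefficientwise.\<close>

lemma exp_powser_recursion:
  fixes p h :: "nat \<Rightarrow> real"
  assumes h: "\<And>s. \<bar>s\<bar> < 1 \<Longrightarrow> (\<lambda>j. h j * s ^ j) sums H s"
    and p: "\<And>s. \<bar>s\<bar> < 1 \<Longrightarrow> (\<lambda>m. p m * s ^ m) sums exp (H s - c)"
  shows "p 0 = exp (h 0 - c)"
    and "real (Suc m) * p (Suc m) = (\<Sum>i=0..m. real (Suc i) * h (Suc i) * p (m - i))"
proof -
  define F where "F = Abs_fps p"
  define G where "G = Abs_fps h"
  have rad: "conv_radius f \<ge> 1" if "\<And>s::real. \<bar>s\<bar> < 1 \<Longrightarrow> summable (\<lambda>j. f j * s ^ j)" for f :: "nat \<Rightarrow> real"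
    by (rule conv_radius_geI_ex') (use that in auto)
  have radF: "fps_conv_radius F \<ge> 1" and radG: "fps_conv_radius G \<ge> 1"
    using sums_summable[OF p] sums_summable[OF h]
    by (auto simp: F_def G_def fps_conv_radius_def intro!: rad)
  have F: "eval_fps F s = exp (H s - c)" and G: "eval_fps G s = H s" if "\<bar>s\<bar> < 1" for s
    using p[OF that] h[OF that] by (auto simp: eval_fps_def F_def G_def sums_iff)
  show "p 0 = exp (h 0 - c)"
    using F[of 0] G[of 0] by (simp add: eval_fps_at_0 F_def G_def)
  have rads: "fps_conv_radius (fps_deriv F) \<ge> 1" "fps_conv_radius (fps_deriv G) \<ge> 1"
    using fps_conv_radius_deriv[of F] fps_conv_radius_deriv[of G] radF radG by (auto intro: order_trans)
  have "fps_deriv F = fps_deriv G * F"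
  proof (rule fps_eqI_unit_disc)
    show "fps_conv_radius (fps_deriv G * F) \<ge> 1"
      by (rule order_trans[OF _ fps_conv_radius_mult]) (use rads radF in auto)
    fix s :: real assume s: "\<bar>s\<bar> < 1"
    have s': "ereal (norm s) < R" if "R \<ge> 1" for R
      by (rule less_le_trans[OF _ that]) (use s in simp)
    \<comment> \<open>\<open>H\<close> is arbitrary outside the disc, but derivatives at
      \<open>s\<close> depend only on a neighbourhood, where \<open>H\<close> and the exponential
      agree with the evaluated series.\<close>
    have ev: "eventually (\<lambda>u::real. \<bar>u\<bar> < 1) (nhds s)"
      by (rule order_tendstoD(2)[of abs "\<bar>s\<bar>"]) (use s in \<open>auto intro!: tendsto_intros filterlim_ident\<close>)
    have "(eval_fps G has_field_derivative eval_fps (fps_deriv G) s) (at s)"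
      by (rule has_field_derivative_eval_fps[OF s'[OF radG]])
    then have "(H has_field_derivative eval_fps (fps_deriv G) s) (at s)"
      by (subst (asm) DERIV_cong_ev[OF refl eventually_mono[OF ev] refl, of _ H]) (use G in auto)
    then have "((\<lambda>s. exp (H s - c)) has_field_derivative exp (H s - c) * eval_fps (fps_deriv G) s) (at s)"
      by (auto intro!: derivative_eq_intros)
    then have 1: "(eval_fps F has_field_derivative exp (H s - c) * eval_fps (fps_deriv G) s) (at s)"
      by (subst DERIV_cong_ev[OF refl eventually_mono[OF ev] refl, of _ "\<lambda>s. exp (H s - c)"]) (use F in auto)
    have 2: "(eval_fps F has_field_derivative eval_fps (fps_deriv F) s) (at s)"
      by (rule has_field_derivative_eval_fps[OF s'[OF radF]])
    have "eval_fps (fps_deriv F) s = exp (H s - c) * eval_fps (fps_deriv G) s"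
      by (rule DERIV_unique[OF 2 1])
    also have "\<dots> = eval_fps (fps_deriv G * F) s"
      using F[OF s] by (simp add: eval_fps_mult[OF s'[OF rads(2)] s'[OF radF]])
    finally show "eval_fps (fps_deriv F) s = eval_fps (fps_deriv G * F) s" .
  qed (rule rads)
  then have "fps_nth (fps_deriv F) m = fps_nth (fps_deriv G * F) m" by simp
  then show "real (Suc m) * p (Suc m) = (\<Sum>i=0..m. real (Suc i) * h (Suc i) * p (m - i))"
    by (simp add: fps_mult_nth F_def G_def)
qed

text \<open>Padding with zeros puts tuples of different weight on one index set. Nothing else is
  added, since an index above \<open>m\<close> with a nonzero entry would already exceed the weight
  \<open>m\<close>; padded entries contribute the factor \<open>w i 0 = 1\<close>.\<close>

lemma sum_B_tuples_extend:
  fixes w :: "nat \<Rightarrow> nat \<Rightarrow> real"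
  assumes "m \<le> K" and w0: "\<And>i. w i 0 = 1"
  shows "(\<Sum>b\<in>B_tuples m. \<Prod>i=1..m. w i (b i)) =
    (\<Sum>b | b \<in> {1..K} \<rightarrow>\<^sub>E UNIV \<and> (\<Sum>i=1..K. i * b i) = m. \<Prod>i=1..K. w i (b i))"
proof (rule sum.reindex_bij_witness[where
      j = "\<lambda>b i. if i \<in> {1..K} then (if i \<le> m then b i else 0) else undefined"
      and i = "\<lambda>b. restrict b {1..m}"])
  have split: "{1..K} = {1..m} \<union> {m<..K}" using assms(1) by auto
  fix b assume b: "b \<in> {b. b \<in> {1..K} \<rightarrow>\<^sub>E UNIV \<and> (\<Sum>i=1..K. i * b i) = m}"
  have b0: "b i = 0" if "i \<in> {m<..K}" for i
  proof -
    have "i * b i \<le> (\<Sum>i=1..K. i * b i)" using that by (intro member_le_sum) auto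
    with b that have "i * b i \<le> m" by simp
    moreover have "m < i" using that by simp
    ultimately show ?thesis by (cases "b i") auto
  qed
  have "(\<Sum>i=1..K. i * b i) = (\<Sum>i=1..m. i * b i) + (\<Sum>i\<in>{m<..K}. i * b i)"
    unfolding split by (rule sum.union_disjoint) auto
  then show "restrict b {1..m} \<in> B_tuples m" using b b0 by (simp add: B_tuples_def)
  show "(\<lambda>i. if i \<in> {1..K} then if i \<le> m then restrict b {1..m} i else 0 else undefined) = b"
    using b b0 by (auto simp: fun_eq_iff PiE_iff extensional_def)
next
  have split: "{1..K} = {1..m} \<union> {m<..K}" using assms(1) by auto
  fix b assume b: "b \<in> B_tuples m"
  let ?b = "\<lambda>i. if i \<in> {1..K} then (if i \<le> m then b i else 0) else undefined"
  show "restrict ?b {1..m} = b"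
    using b assms(1) by (auto simp: B_tuples_def fun_eq_iff PiE_iff extensional_def)
  have "(\<Sum>i=1..K. i * ?b i) = (\<Sum>i=1..m. i * ?b i) + (\<Sum>i\<in>{m<..K}. i * ?b i)"
    unfolding split by (rule sum.union_disjoint) auto
  also have "\<dots> = (\<Sum>i=1..m. i * b i)" using assms(1) by simp
  finally show "?b \<in> {b. b \<in> {1..K} \<rightarrow>\<^sub>E UNIV \<and> (\<Sum>i=1..K. i * b i) = m}"
    using b by (auto simp: B_tuples_def)
  have "(\<Prod>i=1..K. w i (?b i)) = (\<Prod>i=1..m. w i (?b i)) * (\<Prod>i\<in>{m<..K}. w i (?b i))"
    unfolding split by (rule prod.union_disjoint) auto
  also have "\<dots> = (\<Prod>i=1..m. w i (b i))" using assms(1) w0 by simp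
  finally show "(\<Prod>i=1..K. w i (?b i)) = (\<Prod>i=1..m. w i (b i))" .
qed

text \<open>The factor \<open>m\<close> is written as the weight of the tuple and the sums are
  exchanged. The identity b (h^b / b!) = h (h^(b-1) / (b-1)!) then removes one part of size
  \<open>i\<close>, leaving a tuple of weight \<open>m - i\<close>.\<close>

lemma sum_B_tuples_recursion:
  fixes h :: "nat \<Rightarrow> real"
  defines "C \<equiv> \<lambda>m. \<Sum>b\<in>B_tuples m. \<Prod>i=1..m. h i ^ b i / fact (b i)"
  shows "real m * C m = (\<Sum>i=1..m. real i * h i * C (m - i))"
proof -
  let ?w = "\<lambda>b. \<Prod>i=1..m. h i ^ b i / fact (b i)"
  \<comment> \<open>All tuples have length \<open>m\<close> whatever their weight \<open>l\<close>,
    so that lowering one entry stays within the same index set.\<close>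
  define T where "T l = {b. b \<in> {1..m} \<rightarrow>\<^sub>E UNIV \<and> (\<Sum>i=1..m. i * b i) = l}" for l
  have T: "T m = B_tuples m" by (auto simp: T_def B_tuples_def)
  have step: "(\<Sum>b\<in>T m. real (b i) * ?w b) = h i * C (m - i)" if i: "i \<in> {1..m}" for i
  proof -
    have finT: "finite (T m)" by (simp add: T finite_B_tuples)
    \<comment> \<open>Tuples with \<open>b i = 0\<close> contribute nothing; without them truncated
      subtraction by 1 is invertible.\<close>
    have "(\<Sum>b\<in>T m. real (b i) * ?w b) = (\<Sum>b\<in>{b\<in>T m. b i \<noteq> 0}. real (b i) * ?w b)"
      by (rule sum.mono_neutral_right[OF finT]) auto
    also have "\<dots> = (\<Sum>b\<in>T (m - i). h i * ?w b)"
    proof (rule sum.reindex_bij_witness[where j = "\<lambda>b. b(i := b i - 1)" and i = "\<lambda>b. b(i := b i + 1)"])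
      have upd: "(\<Sum>j=1..m. j * (b(i := c)) j) = (\<Sum>j\<in>{1..m}-{i}. j * b j) + i * c"
        "(\<Prod>j=1..m. h j ^ (b(i := c)) j / fact ((b(i := c)) j)) =
          (\<Prod>j\<in>{1..m}-{i}. h j ^ b j / fact (b j)) * (h i ^ c / fact c)" for b :: "nat \<Rightarrow> nat" and c
        by (subst sum.remove[OF _ i] prod.remove[OF _ i]; simp)+
      have rem: "(\<Sum>j=1..m. j * b j) = (\<Sum>j\<in>{1..m}-{i}. j * b j) + i * b i"
        "?w b = (\<Prod>j\<in>{1..m}-{i}. h j ^ b j / fact (b j)) * (h i ^ b i / fact (b i))" for b :: "nat \<Rightarrow> nat"
        by (subst sum.remove[OF _ i] prod.remove[OF _ i]; simp)+
      {
        fix b assume b: "b \<in> {b\<in>T m. b i \<noteq> 0}"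
        then obtain c where c: "b i = Suc c" by (auto simp: gr0_conv_Suc)
        show "(b(i := b i - 1))(i := (b(i := b i - 1)) i + 1) = b" using b by auto
        have "(\<Sum>j\<in>{1..m}-{i}. j * b j) + i * Suc c = m"
          using rem(1)[of b] b c by (simp add: T_def)
        then have "(\<Sum>j=1..m. j * (b(i := b i - 1)) j) = m - i"
          unfolding upd(1) c by (simp add: algebra_simps)
        then show "b(i := b i - 1) \<in> T (m - i)"
          using b i unfolding T_def PiE_iff extensional_def by (simp del: fun_upd_apply) simp
        show "h i * ?w (b(i := b i - 1)) = real (b i) * ?w b"
        proof -
          have "real (Suc c) * (h i ^ Suc c / fact (Suc c)) = h i * (h i ^ c / fact c)"
            by (simp del: of_nat_Suc)
          then show ?thesis
            unfolding upd(2) rem(2)[of b] c diff_Suc_1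
            by (simp only: mult.left_commute[of "real (Suc c)"] mult.left_commute[of "h i"])
        qed
      }
      fix b assume b: "b \<in> T (m - i)"
      show "(b(i := b i + 1))(i := (b(i := b i + 1)) i - 1) = b" by simp
      have "(\<Sum>j\<in>{1..m}-{i}. j * b j) + i * b i = m - i"
        using rem(1)[of b] b by (simp add: T_def)
      then have "(\<Sum>j=1..m. j * (b(i := b i + 1)) j) = m"
        unfolding upd(1) using i by (simp add: algebra_simps)
      then show "b(i := b i + 1) \<in> {b\<in>T m. b i \<noteq> 0}"
        using b i unfolding T_def PiE_iff extensional_def by (simp del: fun_upd_apply) simp
    qed
    also have "\<dots> = h i * (\<Sum>b\<in>T (m - i). ?w b)" by (simp add: sum_distrib_left)
    also have "(\<Sum>b\<in>T (m - i). ?w b) = C (m - i)"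
      unfolding C_def T_def by (rule sum_B_tuples_extend[symmetric]) auto
    finally show ?thesis .
  qed
  have "real m * C m = (\<Sum>b\<in>T m. real (\<Sum>i=1..m. i * b i) * ?w b)"
    unfolding C_def T[symmetric] sum_distrib_left by (rule sum.cong) (auto simp: T_def)
  also have "\<dots> = (\<Sum>b\<in>T m. \<Sum>i=1..m. real i * (real (b i) * ?w b))"
    by (simp add: sum_distrib_right mult.assoc)
  also have "\<dots> = (\<Sum>i=1..m. real i * (\<Sum>b\<in>T m. real (b i) * ?w b))"
    unfolding sum_distrib_left by (rule sum.swap)
  also have "\<dots> = (\<Sum>i=1..m. real i * (h i * C (m - i)))"
    by (rule sum.cong[OF refl]) (simp only: step)
  finally show ?thesis by (simp add: mult.assoc)
qed

text \<open>The constant term \<open>h 0\<close> only enters through the prefactor. After division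
  by it, both sides satisfy the same recursion and start from 1, the value given by the single empty
  tuple.\<close>

lemma exp_powser_coeff:
  fixes p h :: "nat \<Rightarrow> real"
  assumes h: "\<And>s. \<bar>s\<bar> < 1 \<Longrightarrow> (\<lambda>j. h j * s ^ j) sums H s"
    and p: "\<And>s. \<bar>s\<bar> < 1 \<Longrightarrow> (\<lambda>m. p m * s ^ m) sums exp (H s - c)"
  shows "p m = exp (h 0 - c) *
    (\<Sum>b\<in>B_tuples m. (\<Prod>i=1..m. h i ^ b i) / (\<Prod>i=1..m. fact (b i)))"
proof -
  define C where "C m = (\<Sum>b\<in>B_tuples m. \<Prod>i=1..m. h i ^ b i / fact (b i))" for m
  have "p m = exp (h 0 - c) * C m"
  proof (induction m rule: less_induct)
    case (less m)
    show ?case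
    proof (cases m)
      case 0
      have "B_tuples 0 = {\<lambda>_. undefined}" by (auto simp: B_tuples_def)
      then show ?thesis using exp_powser_recursion(1)[OF h p] by (simp add: 0 C_def)
    next
      case (Suc l)
      have "real m * p m = (\<Sum>i=0..l. real (Suc i) * h (Suc i) * p (l - i))"
        using exp_powser_recursion(2)[OF h p, of l] by (simp add: Suc)
      also have "\<dots> = (\<Sum>i=1..m. real i * h i * p (m - i))"
        unfolding Suc One_nat_def by (simp only: sum.shift_bounds_cl_Suc_ivl diff_Suc_Suc)
      also have "\<dots> = (\<Sum>i=1..m. exp (h 0 - c) * (real i * h i * C (m - i)))"
        by (rule sum.cong) (auto simp: less)
      also have "\<dots> = exp (h 0 - c) * (real m * C m)"
        unfolding C_def sum_B_tuples_recursion by (simp add: sum_distrib_left)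
      finally show ?thesis by (simp add: Suc)
    qed
  qed
  then show ?thesis by (simp add: C_def prod_dividef)
qed

section \<open>Clusters\<close>

text \<open>The existentially quantified data behind \<open>matern_cluster_process\<close>, fixed
  once so that parents, their enumeration and the daughters can be named.\<close>

locale matern_clusters = prob_space M
  for M :: "'w measure" and P :: "'w \<Rightarrow> (real^'n) set"
    and X :: "nat \<Rightarrow> 'w \<Rightarrow> real^'n" and D :: "nat \<Rightarrow> 'w \<Rightarrow> (real^'n) set" and lp ld rd :: real +
  assumes params: "lp > 0" "ld > 0" "rd > 0"
    and parents: "poisson_process (\<lambda>_. lp) P"
    and X_meas [measurable]: "random_variable borel (X i)"
    and enum: "AE \<omega> in M. bij_betw (\<lambda>i. X i \<omega>) UNIV (P \<omega>)"
    and daughters: "poisson_process (\<lambda>y. ld * indicator {y. norm y \<le> rd} y) (D i)"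
    and indep_daughters: "indep_vars (\<lambda>_. config_space) D UNIV"
    and indep_parents: "indep_set
          (sets (vimage_algebra (space M) (\<lambda>\<omega> i. X i \<omega>) (PiM UNIV (\<lambda>_. borel))))
          (sets (vimage_algebra (space M) (\<lambda>\<omega> i. D i \<omega>) (PiM UNIV (\<lambda>_. config_space))))"
begin

lemma D_meas [measurable]: "random_variable config_space (D i)"
  by (rule poisson_process_measurable[OF daughters])

lemma D_configurations: "\<omega> \<in> space M \<Longrightarrow> D i \<omega> \<in> configurations"
  using measurable_space[OF D_meas] by simp

lemma X_seq_meas [measurable]: "(\<lambda>\<omega> i. X i \<omega>) \<in> measurable M (PiM UNIV (\<lambda>_. borel))"
  by (rule measurable_PiM_single') auto

lemma D_seq_meas [measurable]: "(\<lambda>\<omega> i. D i \<omega>) \<in> measurable M (PiM UNIV (\<lambda>_. config_space))"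
  by (rule measurable_PiM_single') (auto simp: D_configurations)

lemmas indep_X_D = distr_pair_indep_set[OF X_seq_meas D_seq_meas indep_parents]

lemma X_D_component_meas:
  "(\<lambda>z. (fst z i, snd z i)) \<in>
    measurable (PiM UNIV (\<lambda>_. borel) \<Otimes>\<^sub>M PiM UNIV (\<lambda>_. config_space)) (borel \<Otimes>\<^sub>M config_space)"
  by measurable

definition clusters :: "'w \<Rightarrow> (real^'n) set" where
  "clusters \<omega> = (\<Union>i. (\<lambda>y. X i \<omega> + y) ` D i \<omega>)"

text \<open>A non-measurable set would receive \<open>measure\<close> 0, and \<open>M\<close> is not
  assumed complete, so almost sure agreement with a measurable event would not be enough. The grid
  criterion works for every outcome, including those where the clusters fail to be locally
  finite.\<close>

lemma sets_contact_distance_le: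
  assumes "r \<ge> 0"
  shows "{\<omega> \<in> space M. contact_distance k (clusters \<omega>) \<le> ereal r} \<in> sets M"
  unfolding contact_distance_le_iff[OF assms]
proof (intro sets.sets_Collect_countable_All sets_card_subset)
  fix j m :: nat and c :: "int^'n"
  let ?C = "cball 0 (r + inverse (real (Suc j))) \<inter> {y. grid_index m y = c}"
  have C: "?C \<in> sets borel" "bounded ?C"
    by (intro sets.Int grid_cell_borel borel_closed closed_cball)
       (rule bounded_subset[OF bounded_cball Int_lower1])
  have [measurable]: "Measurable.pred M (\<lambda>\<omega>. \<exists>y\<in>D i \<omega>. X i \<omega> + y \<in> ?C)" for i
    using measurable_compose[OF measurable_Pair[OF X_meas D_meas] measurable_shift_hits[OF C]] by simp
  have "{\<omega> \<in> space M. \<exists>y\<in>clusters \<omega> \<inter> cball 0 (r + inverse (real (Suc j))). grid_index m y = c}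
    = {\<omega> \<in> space M. \<exists>i. \<exists>y\<in>D i \<omega>. X i \<omega> + y \<in> ?C}"
    unfolding clusters_def by blast
  also have "\<dots> \<in> sets M" by measurable
  finally show "{\<omega> \<in> space M. \<exists>y\<in>clusters \<omega> \<inter> cball 0 (r + inverse (real (Suc j))). grid_index m y = c} \<in> sets M" .
qed

text \<open>Independence is used twice: with all parents frozen, cluster \<open>j\<close> is frozen
  as well. Its points then form a countable set of forbidden positions, each of which the
  independent Poisson process \<open>D i\<close> misses almost surely.\<close>

lemma AE_clusters_disjoint:
  assumes "i \<noteq> j"
  shows "AE \<omega> in M. \<forall>y\<in>D i \<omega>. \<forall>y'\<in>D j \<omega>. X i \<omega> + y \<noteq> X j \<omega> + y'"
proof -
  let ?Q = "\<lambda>z. \<forall>y\<in>snd (fst z). \<forall>y'\<in>snd (snd z). fst (fst z) + y \<noteq> fst (snd z) + (y' :: real^'n)"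
  let ?q = "\<lambda>z. ?Q ((fst z i, snd z i), (fst z j, snd z j))"
  have meas: "Measurable.pred (PiM UNIV (\<lambda>_. borel) \<Otimes>\<^sub>M PiM UNIV (\<lambda>_. config_space)) ?q"
    by (rule measurable_compose[OF measurable_Pair[OF X_D_component_meas X_D_component_meas] measurable_shifts_disjoint])
  have indep_ij: "distr M config_space (D j) \<Otimes>\<^sub>M distr M config_space (D i) =
      distr M (config_space \<Otimes>\<^sub>M config_space) (\<lambda>\<omega>. (D j \<omega>, D i \<omega>))"
  proof -
    have "indep_var config_space ((\<lambda>d. d j) \<circ> (\<lambda>\<omega>. restrict (\<lambda>i. D i \<omega>) {j}))
        config_space ((\<lambda>d. d i) \<circ> (\<lambda>\<omega>. restrict (\<lambda>i. D i \<omega>) {i}))"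
      by (rule indep_var_compose[OF indep_var_restrict[OF indep_daughters]]) (use assms in auto)
    then show ?thesis unfolding indep_var_distribution_eq by (simp add: comp_def)
  qed
  have fixed: "AE \<omega> in M. ?q (x, \<lambda>i. D i \<omega>)" for x
  proof -
    \<comment> \<open>The components are swapped because \<open>AE_independent_pair\<close> freezes
      the first one, here \<open>D j\<close>.\<close>
    let ?R = "\<lambda>z. ?Q ((x i, snd z), (x j, fst z))"
    have R: "Measurable.pred (config_space \<Otimes>\<^sub>M config_space) ?R"
      by (rule measurable_compose[OF _ measurable_shifts_disjoint]) measurable
    have "AE \<omega> in M. ?R (D j \<omega>, D i \<omega>)"
    proof (rule AE_independent_pair[OF D_meas D_meas indep_ij R])
      fix N' :: "(real^'n) set" assume "N' \<in> space config_space"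
      then have "countable (\<Union>R::nat. N' \<inter> cball 0 (real R))"
        by (intro countable_UN) (auto intro!: countable_finite finite_configurationsD)
      moreover have "(\<Union>R::nat. N' \<inter> cball 0 (real R)) = N'"
        using real_arch_simple by (auto simp: dist_norm)
      ultimately have "countable N'" by simp
      then have "AE \<omega> in M. \<forall>y'\<in>N'. x j - x i + y' \<notin> D i \<omega>"
        by (subst AE_ball_countable) (auto intro: AE_point_notin_poisson[OF daughters])
      then show "AE \<omega> in M. ?R (N', D i \<omega>)"
      proof eventually_elim
        case (elim \<omega>)
        show ?case
        proof (intro ballI notI; simp)
          fix y y' assume y: "y \<in> D i \<omega>" "y' \<in> N'" "x i + y = x j + y'"
          then have "y = x j - x i + y'" by (simp add: algebra_simps)
          with elim y show False by auto
        qed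
      qed
    qed
    then show ?thesis by simp
  qed
  have "AE \<omega> in M. ?q (\<lambda>i. X i \<omega>, \<lambda>i. D i \<omega>)"
    by (rule AE_independent_pair[OF X_seq_meas D_seq_meas indep_X_D meas fixed])
  then show ?thesis by simp
qed

section \<open>Splitting the points in a ball among the clusters\<close>

definition cluster_count :: "real \<Rightarrow> nat \<Rightarrow> 'w \<Rightarrow> nat" where
  "cluster_count r i \<omega> = card (D i \<omega> \<inter> {y. X i \<omega> + y \<in> cball 0 r})"

lemma cluster_count_meas [measurable]: "cluster_count r i \<in> measurable M (count_space UNIV)"
  unfolding cluster_count_def
  using measurable_compose[OF measurable_Pair[OF X_meas D_meas] measurable_card_shift[of "cball 0 r"]] by simp

lemma AE_typical:
  "AE \<omega> in M. bij_betw (\<lambda>i. X i \<omega>) UNIV (P \<omega>) \<and> P \<omega> \<in> configurations \<and>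
    (\<forall>i. D i \<omega> \<in> configurations \<and> D i \<omega> \<subseteq> cball 0 rd) \<and>
    (\<forall>i j. i \<noteq> j \<longrightarrow> (\<forall>y\<in>D i \<omega>. \<forall>y'\<in>D j \<omega>. X i \<omega> + y \<noteq> X j \<omega> + y'))"
proof -
  have 1: "AE \<omega> in M. \<forall>i. D i \<omega> \<subseteq> cball 0 rd"
    unfolding AE_all_countable by (auto intro!: AE_poisson_empty[OF daughters])
  have 2: "AE \<omega> in M. \<forall>i j. i \<noteq> j \<longrightarrow> (\<forall>y\<in>D i \<omega>. \<forall>y'\<in>D j \<omega>. X i \<omega> + y \<noteq> X j \<omega> + y')"
    unfolding AE_all_countable
  proof (intro allI)
    fix i j :: nat
    show "AE \<omega> in M. i \<noteq> j \<longrightarrow> (\<forall>y\<in>D i \<omega>. \<forall>y'\<in>D j \<omega>. X i \<omega> + y \<noteq> X j \<omega> + y')"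
      by (cases "i = j") (use AE_clusters_disjoint[of i j] in auto)
  qed
  have 3: "AE \<omega> in M. P \<omega> \<in> configurations"
    using measurable_space[OF poisson_process_measurable[OF parents]] by (intro AE_I2) simp
  have 4: "AE \<omega> in M. \<forall>i. D i \<omega> \<in> configurations"
    using D_configurations by (intro AE_I2) simp
  from enum 1 2 3 4 show ?thesis by eventually_elim blast
qed

lemma finite_parents_near:
  assumes "bij_betw (\<lambda>i. X i \<omega>) UNIV (P \<omega>)" "P \<omega> \<in> configurations"
  shows "finite {i. norm (X i \<omega>) \<le> R}"
proof -
  have "(\<lambda>i. X i \<omega>) ` {i. norm (X i \<omega>) \<le> R} \<subseteq> P \<omega> \<inter> cball 0 R"
    using assms(1) by (auto simp: bij_betw_def)
  then have "finite ((\<lambda>i. X i \<omega>) ` {i. norm (X i \<omega>) \<le> R})"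
    by (rule finite_subset) (intro finite_configurationsD assms(2) bounded_cball)
  moreover have "inj_on (\<lambda>i. X i \<omega>) {i. norm (X i \<omega>) \<le> R}"
    using assms(1) by (auto simp: bij_betw_def intro: inj_on_subset)
  ultimately show ?thesis by (rule finite_imageD)
qed

text \<open>Daughters stay within \<open>rd\<close> of their parent, so only parents within
  \<open>r + rd\<close> can reach the ball. These are finitely many, and disjointness of the
  clusters makes their counts add up.\<close>

lemma AE_clusters_count:
  "AE \<omega> in M. finite (clusters \<omega> \<inter> cball 0 r) \<and>
     eventually (\<lambda>l. (\<Sum>i<l. cluster_count r i \<omega>) = card (clusters \<omega> \<inter> cball 0 r)) sequentially"
  using AE_typical
proof eventually_elim
  case (elim \<omega>)
  then have bij: "bij_betw (\<lambda>i. X i \<omega>) UNIV (P \<omega>)" and Pc: "P \<omega> \<in> configurations"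
    and Dc: "\<And>i. D i \<omega> \<in> configurations" and Dr: "\<And>i. D i \<omega> \<subseteq> cball 0 rd"
    and disj: "\<And>i j y y'. i \<noteq> j \<Longrightarrow> y \<in> D i \<omega> \<Longrightarrow> y' \<in> D j \<omega> \<Longrightarrow> X i \<omega> + y \<noteq> X j \<omega> + y'"
    by blast+
  define I where "I = {i. norm (X i \<omega>) \<le> r + rd}"
  have finI: "finite I" unfolding I_def by (rule finite_parents_near[OF bij Pc])
  define E where "E i = D i \<omega> \<inter> {y. X i \<omega> + y \<in> cball 0 r}" for i
  have E0: "E i = {}" if "i \<notin> I" for i
  proof (rule ccontr)
    assume "E i \<noteq> {}"
    then obtain y where y: "y \<in> D i \<omega>" "norm (X i \<omega> + y) \<le> r" by (auto simp: E_def)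
    have "norm y \<le> rd" using y(1) Dr[of i] by auto
    then have "norm (X i \<omega>) \<le> r + rd"
      using y(2) norm_triangle_ineq4[of "X i \<omega> + y" y] by simp
    with that show False by (simp add: I_def)
  qed
  have finE: "finite (E i)" for i
    unfolding E_def by (rule finite_subset[OF _ finite_configurationsD[OF Dc bounded_cball[of 0 rd]]]) (use Dr[of i] in auto)
  have "clusters \<omega> \<inter> cball 0 r = (\<Union>i. (\<lambda>y. X i \<omega> + y) ` E i)"
    by (auto simp: clusters_def E_def)
  also have "\<dots> = (\<Union>i\<in>I. (\<lambda>y. X i \<omega> + y) ` E i)" using E0 by blast
  finally have un: "clusters \<omega> \<inter> cball 0 r = (\<Union>i\<in>I. (\<lambda>y. X i \<omega> + y) ` E i)" .
  have "card (clusters \<omega> \<inter> cball 0 r) = (\<Sum>i\<in>I. card ((\<lambda>y. X i \<omega> + y) ` E i))"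
    unfolding un
  proof (rule card_UN_disjoint[OF finI])
    show "\<forall>i\<in>I. \<forall>j\<in>I. i \<noteq> j \<longrightarrow> (\<lambda>y. X i \<omega> + y) ` E i \<inter> (\<lambda>y. X j \<omega> + y) ` E j = {}"
      using disj unfolding E_def by blast
  qed (use finE in auto)
  also have "\<dots> = (\<Sum>i\<in>I. cluster_count r i \<omega>)"
    by (rule sum.cong[OF refl]) (auto simp: card_image cluster_count_def E_def)
  finally have card: "card (clusters \<omega> \<inter> cball 0 r) = (\<Sum>i\<in>I. cluster_count r i \<omega>)" .
  obtain l0 where l0: "I \<subseteq> {..<l0}" using finite_nat_bounded[OF finI] by blast
  have "(\<Sum>i<l. cluster_count r i \<omega>) = card (clusters \<omega> \<inter> cball 0 r)" if "l0 \<le> l" for l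
    unfolding card
  proof (rule sum.mono_neutral_right)
    show "I \<subseteq> {..<l}" using l0 that by auto
    show "\<forall>i\<in>{..<l} - I. cluster_count r i \<omega> = 0"
      using E0 by (auto simp: cluster_count_def E_def)
  qed simp
  moreover have "finite (clusters \<omega> \<inter> cball 0 r)"
    unfolding un using finI finE by auto
  ultimately show ?case by (auto intro: eventually_sequentiallyI)
qed

text \<open>The mean number of points in the ball for a cluster with parent at \<open>x\<close>. It
  takes the position rather than its norm, since the parent process is integrated over space before
  passing to polar coordinates.\<close>

definition mean_count :: "real \<Rightarrow> real^'n \<Rightarrow> real" where
  "mean_count r x = ld * measure lborel (cball 0 r \<inter> cball x rd)"

lemma mean_count_eq:
  "(LINT y:{y. x + y \<in> cball 0 r}|lborel. ld * indicator {y. norm y \<le> rd} y) = mean_count r x"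
proof -
  have eq: "indicator {y. x + y \<in> cball 0 r} y *\<^sub>R (ld * indicator {y. norm y \<le> rd} y) =
      ld * indicator (cball 0 r \<inter> cball x rd) (x + y)" for y
    by (auto simp: indicator_def dist_norm)
  have "(LINT y:{y. x + y \<in> cball 0 r}|lborel. ld * indicator {y. norm y \<le> rd} y) =
      ld * (LINT y|lborel. indicator (cball 0 r \<inter> cball x rd) (x + y))"
    unfolding set_lebesgue_integral_def eq by (rule integral_mult_right_zero)
  also have "(LINT y|lborel. indicator (cball 0 r \<inter> cball x rd) (x + y)) =
      (LINT y|lborel. indicator (cball 0 r \<inter> cball x rd) y :: real)"
    by (subst (2) lborel_distr_plus[of x, symmetric], subst integral_distr)
       (auto intro!: borel_measurable_indicator sets.Int borel_closed)
  finally show ?thesis by (simp add: mean_count_def)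
qed

end

section \<open>The number of points in a ball\<close>

context matern_clusters
begin

lemma mean_count_measurable [measurable]: "mean_count r \<in> borel_measurable borel"
  unfolding mean_count_def using borel_measurable_cball_Int_cball by measurable

lemma mean_count_nonneg: "0 \<le> mean_count r x"
  using params by (simp add: mean_count_def)

lemma mean_count_le: "mean_count r x \<le> ld * measure lborel (cball (0 :: real^'n) r)"
  unfolding mean_count_def
  by (intro mult_left_mono measure_mono_fmeasurable) (use params in \<open>auto intro!: fmeasurableI
      simp: emeasure_lborel_cball_finite[unfolded infinity_ennreal_def]\<close>)

lemma mean_count_eq_0:
  assumes "norm x > r + rd"
  shows "mean_count r x = 0"
proof -
  have "cball 0 r \<inter> cball x rd = {}"
  proof (rule ccontr)
    assume "cball 0 r \<inter> cball x rd \<noteq> {}"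
    then obtain y where "norm y \<le> r" "norm (x - y) \<le> rd" by (auto simp: dist_norm)
    with assms norm_triangle_ineq[of "x - y" y] show False by simp
  qed
  then show ?thesis by (simp add: mean_count_def)
qed

text \<open>With the parent positions frozen, the first \<open>l\<close> counts are independent
  Poisson variables, so the inner expectation is a finite product of exponentials; averaging over
  the parents remains.\<close>

lemma expectation_power_partial_count:
  assumes s: "\<bar>s\<bar> \<le> 1"
  shows "expectation (\<lambda>\<omega>. s ^ (\<Sum>i<l. cluster_count r i \<omega>)) =
    expectation (\<lambda>\<omega>. exp (- (\<Sum>i<l. (1 - s) * mean_count r (X i \<omega>))))"
proof -
  let ?S = "PiM UNIV (\<lambda>_ :: nat. borel :: (real^'n) measure)" and ?T = "PiM UNIV (\<lambda>_ :: nat. config_space :: (real^'n) set measure)"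
  let ?C = "\<lambda>x. {y. x + y \<in> cball 0 r} :: (real^'n) set"
  let ?f = "\<lambda>z. \<Prod>i<l. s ^ card (snd z i \<inter> ?C (fst z i))"
  \<comment> \<open>Seen from the parent, the observation ball is again a ball, hence Borel and
    bounded.\<close>
  have C: "?C x = cball (- x) r" for x by (auto simp: dist_norm norm_minus_commute)
  have [measurable]: "(\<lambda>z. card (snd z i \<inter> ?C (fst z i))) \<in> measurable (?S \<Otimes>\<^sub>M ?T) (count_space UNIV)" for i
    using measurable_compose[OF X_D_component_meas measurable_card_shift[of "cball 0 r"]] by simp
  have f: "?f \<in> borel_measurable (?S \<Otimes>\<^sub>M ?T)" by measurable
  have bound: "\<bar>?f z\<bar> \<le> 1" for z
    using s by (auto simp: abs_prod power_abs intro!: prod_le_1 power_le_one)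
  have inner: "expectation (\<lambda>\<omega>'. ?f (x, \<lambda>i. D i \<omega>')) = exp (- (\<Sum>i<l. (1 - s) * mean_count r (x i)))" for x
  proof -
    have card_meas: "(\<lambda>N. card (N \<inter> ?C (x i))) \<in> measurable config_space (count_space UNIV)" for i
      unfolding C by (rule measurable_card_config) auto
    have "indep_vars (\<lambda>_. config_space) D {..<l}"
      by (rule indep_vars_subset[OF indep_daughters]) simp
    then have ind: "indep_vars (\<lambda>_. borel) (\<lambda>i \<omega>'. s ^ card (D i \<omega>' \<inter> ?C (x i))) {..<l}"
      by (rule indep_vars_compose2) (rule measurable_compose[OF card_meas], simp)
    have int: "integrable M (\<lambda>\<omega>'. s ^ card (D i \<omega>' \<inter> ?C (x i)))" for i
    proof (rule integrable_const_bound[where B = 1])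
      show "AE \<omega>' in M. norm (s ^ card (D i \<omega>' \<inter> ?C (x i))) \<le> 1"
        using s by (intro AE_I2) (auto simp: power_abs intro!: power_le_one)
      show "(\<lambda>\<omega>'. s ^ card (D i \<omega>' \<inter> ?C (x i))) \<in> borel_measurable M"
        by (rule measurable_compose[OF measurable_compose[OF D_meas card_meas]]) simp
    qed
    have one: "expectation (\<lambda>\<omega>'. s ^ card (D i \<omega>' \<inter> ?C (x i))) = exp (- ((1 - s) * mean_count r (x i)))" for i
      unfolding mean_count_eq[symmetric] mult_minus_left[symmetric]
      by (rule expectation_power_card_poisson[OF daughters _ _ s]) (unfold C, auto)
    have "expectation (\<lambda>\<omega>'. \<Prod>i<l. s ^ card (D i \<omega>' \<inter> ?C (x i))) =
        (\<Prod>i<l. expectation (\<lambda>\<omega>'. s ^ card (D i \<omega>' \<inter> ?C (x i))))"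
      by (rule indep_vars_lebesgue_integral[OF _ ind]) (use int in auto)
    then show ?thesis by (simp only: one fst_conv snd_conv sum_negf[symmetric] exp_sum[OF finite_lessThan])
  qed
  have "expectation (\<lambda>\<omega>. ?f (\<lambda>i. X i \<omega>, \<lambda>i. D i \<omega>)) =
      expectation (\<lambda>\<omega>. expectation (\<lambda>\<omega>'. ?f (\<lambda>i. X i \<omega>, \<lambda>i. D i \<omega>')))"
    by (rule expectation_independent_pair[OF X_seq_meas D_seq_meas indep_X_D f bound])
  then show ?thesis
    unfolding inner by (simp only: cluster_count_def power_sum fst_conv snd_conv)
qed

text \<open>Almost surely the partial sums of the cluster counts are eventually constant; on the exceptional null
  set the limit is an arbitrary number.\<close>

definition total_count :: "real \<Rightarrow> 'w \<Rightarrow> nat" where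
  "total_count r \<omega> = nat \<lfloor>lim (\<lambda>l. real (\<Sum>i<l. cluster_count r i \<omega>))\<rfloor>"

lemma total_count_meas [measurable]: "total_count r \<in> measurable M (count_space UNIV)"
proof -
  have "(\<lambda>\<omega>. lim (\<lambda>l. real (\<Sum>i<l. cluster_count r i \<omega>))) \<in> borel_measurable M"
    by (rule borel_measurable_lim_metric) measurable
  then show ?thesis unfolding total_count_def by measurable
qed

lemma AE_total_count:
  "AE \<omega> in M. total_count r \<omega> = card (clusters \<omega> \<inter> cball 0 r) \<and>
     eventually (\<lambda>l. (\<Sum>i<l. cluster_count r i \<omega>) = total_count r \<omega>) sequentially"
  using AE_clusters_count[of r]
proof eventually_elim
  case (elim \<omega>)
  then have ev: "eventually (\<lambda>l. (\<Sum>i<l. cluster_count r i \<omega>) = card (clusters \<omega> \<inter> cball 0 r)) sequentially"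
    by blast
  then have "(\<lambda>l. real (\<Sum>i<l. cluster_count r i \<omega>)) \<longlonglongrightarrow> real (card (clusters \<omega> \<inter> cball 0 r))"
    by (intro tendsto_eventually eventually_mono[OF ev]) (simp only:)
  from limI[OF this] have "total_count r \<omega> = card (clusters \<omega> \<inter> cball 0 r)"
    unfolding total_count_def by simp
  with ev show ?case by simp
qed

text \<open>The enumeration without repetition turns a sum over indices into a sum over points of
  \<open>P\<close>, as the Laplace functional requires; parents beyond \<open>r + rd\<close>
  contribute 0.\<close>

lemma AE_sum_mean_count:
  "AE \<omega> in M. eventually (\<lambda>l. (\<Sum>i<l. c * mean_count r (X i \<omega>)) =
      (\<Sum>y\<in>P \<omega> \<inter> cball 0 (r + rd). c * mean_count r y)) sequentially"
  using AE_typical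
proof eventually_elim
  case (elim \<omega>)
  then have bij: "bij_betw (\<lambda>i. X i \<omega>) UNIV (P \<omega>)" and Pc: "P \<omega> \<in> configurations" by blast+
  define I where "I = {i. norm (X i \<omega>) \<le> r + rd}"
  have finI: "finite I" unfolding I_def by (rule finite_parents_near[OF bij Pc])
  have "bij_betw (\<lambda>i. X i \<omega>) I (P \<omega> \<inter> cball 0 (r + rd))"
  proof (rule bij_betw_subset[OF bij])
    have "P \<omega> = range (\<lambda>i. X i \<omega>)" using bij by (simp add: bij_betw_def)
    then show "(\<lambda>i. X i \<omega>) ` I = P \<omega> \<inter> cball 0 (r + rd)" by (auto simp: I_def)
  qed simp
  then have sumI: "(\<Sum>y\<in>P \<omega> \<inter> cball 0 (r + rd). c * mean_count r y) = (\<Sum>i\<in>I. c * mean_count r (X i \<omega>))"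
    by (rule sum.reindex_bij_betw[symmetric])
  obtain l0 where l0: "I \<subseteq> {..<l0}" using finite_nat_bounded[OF finI] by blast
  show ?case
  proof (rule eventually_sequentiallyI)
    fix l assume "l0 \<le> l"
    then show "(\<Sum>i<l. c * mean_count r (X i \<omega>)) = (\<Sum>y\<in>P \<omega> \<inter> cball 0 (r + rd). c * mean_count r y)"
      unfolding sumI by (intro sum.mono_neutral_right) (use l0 mean_count_eq_0 in \<open>auto simp: I_def\<close>)
  qed
qed

text \<open>The number of clusters tends to infinity on both sides of the partial identity. Since
  \<open>1 - s\<close> is nonnegative, the exponentials are bounded by 1 just as the powers of
  \<open>s\<close> are.\<close>

lemma expectation_power_total_count:
  assumes s: "\<bar>s\<bar> \<le> 1"
  shows "expectation (\<lambda>\<omega>. s ^ total_count r \<omega>) =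
    exp (- lp * (LINT x:cball 0 (r + rd)|lborel. 1 - exp (- ((1 - s) * mean_count r x))))"
proof -
  have s1: "0 \<le> 1 - s" using s by linarith
  have "(\<lambda>l. expectation (\<lambda>\<omega>. s ^ (\<Sum>i<l. cluster_count r i \<omega>))) \<longlonglongrightarrow> expectation (\<lambda>\<omega>. s ^ total_count r \<omega>)"
  proof (rule integral_dominated_convergence[where w = "\<lambda>_. 1"])
    show "AE \<omega> in M. (\<lambda>l. s ^ (\<Sum>i<l. cluster_count r i \<omega>)) \<longlonglongrightarrow> s ^ total_count r \<omega>"
      using AE_total_count[of r] by eventually_elim (auto intro!: tendsto_eventually elim: eventually_mono)
    show "AE \<omega> in M. norm (s ^ (\<Sum>i<l. cluster_count r i \<omega>)) \<le> 1" for l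
      using s by (auto simp: power_abs intro!: power_le_one)
  qed auto
  \<comment> \<open>The Laplace functional was established for bounded functions; a cluster puts on
    average at most \<open>ld\<close> times the volume of the observation ball into it.\<close>
  obtain K :: nat where "(1 - s) * (ld * measure lborel (cball (0 :: real^'n) r)) \<le> real K"
    using real_arch_simple by blast
  then have K: "(1 - s) * mean_count r x \<le> real K" for x
    using mult_left_mono[OF mean_count_le s1] by (rule order_trans[rotated])
  note lap = poisson_laplace_functional[OF parents _ _ _ _ K, of "cball 0 (r + rd)"]
  have meas: "(\<lambda>\<omega>. exp (- (\<Sum>y\<in>P \<omega> \<inter> cball 0 (r + rd). (1 - s) * mean_count r y))) \<in> borel_measurable M"
    by (rule lap(2)) (use s1 in \<open>auto intro!: mult_nonneg_nonneg mean_count_nonneg\<close>)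
  have "(\<lambda>l. expectation (\<lambda>\<omega>. exp (- (\<Sum>i<l. (1 - s) * mean_count r (X i \<omega>))))) \<longlonglongrightarrow>
      expectation (\<lambda>\<omega>. exp (- (\<Sum>y\<in>P \<omega> \<inter> cball 0 (r + rd). (1 - s) * mean_count r y)))"
  proof (rule integral_dominated_convergence[where w = "\<lambda>_. 1", OF meas])
    show "AE \<omega> in M. (\<lambda>l. exp (- (\<Sum>i<l. (1 - s) * mean_count r (X i \<omega>)))) \<longlonglongrightarrow>
        exp (- (\<Sum>y\<in>P \<omega> \<inter> cball 0 (r + rd). (1 - s) * mean_count r y))"
      using AE_sum_mean_count[of "1 - s" r]
      by eventually_elim (auto intro!: tendsto_eventually elim: eventually_mono)
    show "AE \<omega> in M. norm (exp (- (\<Sum>i<l. (1 - s) * mean_count r (X i \<omega>)))) \<le> 1" for l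
      using s1 by (auto intro!: sum_nonneg mult_nonneg_nonneg mean_count_nonneg)
  qed auto
  also have "expectation (\<lambda>\<omega>. exp (- (\<Sum>y\<in>P \<omega> \<inter> cball 0 (r + rd). (1 - s) * mean_count r y))) =
      exp (- (LINT x:cball 0 (r + rd)|lborel. (1 - exp (- ((1 - s) * mean_count r x))) * lp))"
    by (rule lap(1)) (use s1 in \<open>auto intro!: mult_nonneg_nonneg mean_count_nonneg\<close>)
  also have "\<dots> = exp (- lp * (LINT x:cball 0 (r + rd)|lborel. 1 - exp (- ((1 - s) * mean_count r x))))"
    by (simp add: mult.commute)
  finally show ?thesis
    unfolding expectation_power_partial_count[OF s, symmetric]
    by (rule LIMSEQ_unique[rotated]) fact
qed

text \<open>Undoes the polar coordinates. The integrand is the Poisson probability of exactly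
  \<open>j\<close> points, so h_j is the mean number of parents within \<open>r + rd\<close> whose
  cluster has \<open>j\<close> points in the ball.\<close>

lemma h_fun_eq:
  assumes r: "r > 0"
  shows "h_fun TYPE('n) lp ld rd j r =
    lp * (LINT x:cball 0 (r + rd)|lborel. mean_count r x ^ j / fact j * exp (- mean_count r x))"
proof -
  \<comment> \<open>By rotation invariance the radial profile of \<open>mean_count\<close> can be
    read off along any unit vector.\<close>
  obtain e :: "real^'n" where e: "norm e = 1" using vector_choose_size[of 1] by auto
  define m where "m t = mean_count r (t *\<^sub>R e)" for t
  have m_norm: "m (norm x) = mean_count r x" for x
    unfolding m_def mean_count_def by (subst measure_cball_Int_cball_cong[of _ x]) (simp_all add: e)
  have m_vol: "ld * ball_inter_volume TYPE('n) r rd t = m t" if "t \<ge> 0" for t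
    unfolding m_def mean_count_def by (subst ball_inter_volume_eq) (use that e in auto)
  have [measurable]: "m \<in> borel_measurable borel" unfolding m_def by measurable
  have "(LINT x:cball 0 (r + rd)|lborel. mean_count r x ^ j / fact j * exp (- mean_count r x)) =
      (LINT x:cball (0 :: real^'n) (r + rd)|lborel. m (norm x) ^ j / fact j * exp (- m (norm x)))"
    by (simp add: m_norm)
  also have "\<dots> = real CARD('n) * unit_ball_vol (real CARD('n)) *
      (LINT t:{0..r + rd}|lborel. m t ^ j / fact j * exp (- m t) * t ^ (CARD('n) - 1))"
    by (rule integral_cball_norm) (use r params in auto)
  also have "(LINT t:{0..r + rd}|lborel. m t ^ j / fact j * exp (- m t) * t ^ (CARD('n) - 1)) =
      (LINT t:{0..r + rd}|lborel. ((ld * ball_inter_volume TYPE('n) r rd t) ^ j *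
        exp (- ld * ball_inter_volume TYPE('n) r rd t) * t ^ (CARD('n) - 1)) / fact j)"
    by (rule set_lebesgue_integral_cong) (auto simp: m_vol)
  finally show ?thesis unfolding h_fun_def by simp
qed

text \<open>Exchanges series and integral. The uniform bound \<open>?A\<close> on
  \<open>mean_count\<close> dominates the terms by those of an exponential series on a ball of
  finite volume.\<close>

lemma h_fun_sums:
  assumes r: "r > 0"
  shows "(\<lambda>j. h_fun TYPE('n) lp ld rd j r * s ^ j) sums
    (lp * (LINT x:cball 0 (r + rd)|lborel. exp (- ((1 - s) * mean_count r x))))"
proof -
  let ?B = "cball (0 :: real^'n) (r + rd)" and ?A = "ld * measure lborel (cball (0 :: real^'n) r)"
  define g where "g j x = indicator ?B x *\<^sub>R ((mean_count r x * s) ^ j / fact j * exp (- mean_count r x))" for j x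
  have bound: "norm (g j x) \<le> indicator ?B x *\<^sub>R ((?A * \<bar>s\<bar>) ^ j / fact j)" for j x
  proof -
    have "(mean_count r x * \<bar>s\<bar>) ^ j / fact j * exp (- mean_count r x) \<le> (?A * \<bar>s\<bar>) ^ j / fact j * 1"
      by (intro mult_mono divide_right_mono power_mono mult_right_mono mean_count_le)
         (auto simp: mean_count_nonneg params less_imp_le)
    then show ?thesis
      by (auto simp: g_def abs_mult power_abs mean_count_nonneg split: split_indicator)
  qed
  have intB: "integrable lborel (\<lambda>x. indicator ?B x *\<^sub>R c)" for c :: real
    by (intro integrable_scaleR_left integrable_real_indicator) (auto simp: emeasure_lborel_cball_finite[unfolded infinity_ennreal_def])
  have [measurable]: "?B \<in> sets lborel" "mean_count r \<in> borel_measurable lborel"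
    using mean_count_measurable by simp_all
  have [measurable]: "g j \<in> borel_measurable lborel" for j unfolding g_def by measurable
  have int: "integrable lborel (g j)" for j
    by (rule Bochner_Integration.integrable_bound[OF intB[of "(?A * \<bar>s\<bar>) ^ j / fact j"]])
       (use bound order_trans[OF bound abs_ge_self] in auto)
  have exps: "(\<lambda>j. a ^ j / fact j) sums exp a" for a :: real
    using exp_converges[of a] by (simp add: divide_inverse mult.commute)
  have "(\<lambda>j. \<integral>x. g j x \<partial>lborel) sums (\<integral>x. (\<Sum>j. g j x) \<partial>lborel)"
  proof (rule sums_integral[OF int])
    show "AE x in lborel. summable (\<lambda>j. norm (g j x))"
    proof (rule AE_I2)
      fix x
      have "summable (\<lambda>j. indicator ?B x *\<^sub>R ((?A * \<bar>s\<bar>) ^ j / fact j))"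
        by (intro summable_scaleR_right sums_summable[OF exps])
      then show "summable (\<lambda>j. norm (g j x))"
        by (rule summable_comparison_test') (use bound in auto)
    qed
    show "summable (\<lambda>j. \<integral>x. norm (g j x) \<partial>lborel)"
    proof (rule summable_comparison_test')
      show "summable (\<lambda>j. measure lborel ?B * ((?A * \<bar>s\<bar>) ^ j / fact j))"
        by (intro summable_mult sums_summable[OF exps])
      fix j
      have "(\<integral>x. norm (g j x) \<partial>lborel) \<le> (\<integral>x. indicator ?B x *\<^sub>R ((?A * \<bar>s\<bar>) ^ j / fact j) \<partial>lborel)"
        by (intro integral_mono integrable_norm int intB bound)
      then show "norm (\<integral>x. norm (g j x) \<partial>lborel) \<le> measure lborel ?B * ((?A * \<bar>s\<bar>) ^ j / fact j)"
        by simp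
    qed
  qed
  moreover have "(\<Sum>j. g j x) = indicator ?B x *\<^sub>R exp (- ((1 - s) * mean_count r x))" for x
  proof -
    have "(\<lambda>j. g j x) sums (indicator ?B x *\<^sub>R (exp (mean_count r x * s) * exp (- mean_count r x)))"
      unfolding g_def by (intro sums_scaleR_right sums_mult2 exps)
    then show ?thesis by (simp add: sums_iff algebra_simps flip: exp_add)
  qed
  ultimately have "(\<lambda>j. \<integral>x. g j x \<partial>lborel) sums (LINT x:?B|lborel. exp (- ((1 - s) * mean_count r x)))"
    by (simp add: set_lebesgue_integral_def)
  then have "(\<lambda>j. lp * (\<integral>x. g j x \<partial>lborel)) sums (lp * (LINT x:?B|lborel. exp (- ((1 - s) * mean_count r x))))"
    by (rule sums_mult)
  moreover have "lp * (\<integral>x. g j x \<partial>lborel) = h_fun TYPE('n) lp ld rd j r * s ^ j" for j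
  proof -
    have "g j = (\<lambda>x. indicator ?B x *\<^sub>R (mean_count r x ^ j / fact j * exp (- mean_count r x)) * s ^ j)"
      by (auto simp: g_def fun_eq_iff power_mult_distrib)
    then show ?thesis by (simp add: h_fun_eq[OF r] set_lebesgue_integral_def)
  qed
  ultimately show ?thesis by simp
qed

text \<open>The integrand 1 - exp(...) is split: the integral of 1 over the ball of radius
  \<open>r + rd\<close> supplies the subtracted constant, and the exponential part is the series of
  the h_j.\<close>

lemma prob_total_count:
  assumes r: "r > 0"
  defines "h \<equiv> h_fun TYPE('n) lp ld rd"
  shows "prob {\<omega> \<in> space M. total_count r \<omega> = m} =
    exp (h 0 r - lp * unit_ball_vol (real CARD('n)) * (r + rd) ^ CARD('n)) *
      (\<Sum>b\<in>B_tuples m. (\<Prod>i=1..m. h i r ^ b i) / (\<Prod>i=1..m. fact (b i)))"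
proof (rule exp_powser_coeff)
  fix s :: real assume s: "\<bar>s\<bar> < 1"
  let ?B = "cball (0 :: real^'n) (r + rd)"
  let ?H = "lp * (LINT x:?B|lborel. exp (- ((1 - s) * mean_count r x)))"
  show "(\<lambda>j. h j r * s ^ j) sums ?H"
    unfolding h_def by (rule h_fun_sums[OF r])
  have intB: "set_integrable lborel ?B (\<lambda>_. 1 :: real)"
    unfolding set_integrable_def
    by (intro integrable_scaleR_left integrable_real_indicator) (auto simp: emeasure_lborel_cball_finite[unfolded infinity_ennreal_def])
  have [measurable]: "?B \<in> sets lborel" "mean_count r \<in> borel_measurable lborel"
    using mean_count_measurable by simp_all
  have "set_borel_measurable lborel ?B (\<lambda>x. exp (- ((1 - s) * mean_count r x)))"
    unfolding set_borel_measurable_def by measurable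
  then have "set_integrable lborel ?B (\<lambda>x. exp (- ((1 - s) * mean_count r x)))"
    by (rule set_integrable_bound[OF intB])
       (use s in \<open>auto intro!: mult_nonneg_nonneg mean_count_nonneg\<close>)
  then have "(LINT x:?B|lborel. 1 - exp (- ((1 - s) * mean_count r x))) =
      (LINT x:?B|lborel. 1) - (LINT x:?B|lborel. exp (- ((1 - s) * mean_count r x)))"
    by (rule set_integral_diff(2)[OF intB])
  also have "(LINT x:?B|lborel. 1) = unit_ball_vol (real CARD('n)) * (r + rd) ^ CARD('n)"
    using r params by (simp add: set_lebesgue_integral_def content_cball)
  finally have eq: "(LINT x:?B|lborel. 1 - exp (- ((1 - s) * mean_count r x))) =
      unit_ball_vol (real CARD('n)) * (r + rd) ^ CARD('n) -
      (LINT x:?B|lborel. exp (- ((1 - s) * mean_count r x)))" .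
  have vol: "- lp * (LINT x:?B|lborel. 1 - exp (- ((1 - s) * mean_count r x))) =
      ?H - lp * unit_ball_vol (real CARD('n)) * (r + rd) ^ CARD('n)"
    unfolding eq by (simp add: right_diff_distrib mult.assoc)
  have "(\<lambda>m. prob {\<omega> \<in> space M. total_count r \<omega> = m} * s ^ m) sums expectation (\<lambda>\<omega>. s ^ total_count r \<omega>)"
    by (rule pgf_sums) (use s in auto)
  then show "(\<lambda>m. prob {\<omega> \<in> space M. total_count r \<omega> = m} * s ^ m) sums
      exp (?H - lp * unit_ball_vol (real CARD('n)) * (r + rd) ^ CARD('n))"
    unfolding vol[symmetric] by (subst expectation_power_total_count[symmetric]) (use s in auto)
qed

lemma prob_contact_distance_le:
  assumes r: "r > 0"
  defines "h \<equiv> h_fun TYPE('n) lp ld rd"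
  shows "prob {\<omega> \<in> space M. contact_distance k (clusters \<omega>) \<le> ereal r} =
    1 - exp (h 0 r - lp * unit_ball_vol (real CARD('n)) * (r + rd) ^ CARD('n)) *
      (\<Sum>m<k. \<Sum>b\<in>B_tuples m. (\<Prod>i=1..m. h i r ^ b i) / (\<Prod>i=1..m. fact (b i)))"
proof -
  have "prob {\<omega> \<in> space M. contact_distance k (clusters \<omega>) \<le> ereal r} =
      prob {\<omega> \<in> space M. \<not> total_count r \<omega> < k}"
  proof (rule finite_measure_eq_AE)
    show "{\<omega> \<in> space M. contact_distance k (clusters \<omega>) \<le> ereal r} \<in> events"
      by (rule sets_contact_distance_le) (use r in simp)
    show "AE \<omega> in M. (\<omega> \<in> {\<omega> \<in> space M. contact_distance k (clusters \<omega>) \<le> ereal r}) =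
        (\<omega> \<in> {\<omega> \<in> space M. \<not> total_count r \<omega> < k})"
      \<comment> \<open>The count is needed at radius \<open>r\<close>, but finiteness at radius
        \<open>r + 1\<close>, where \<open>contact_distance_le_iff_card\<close> looks for further
        points.\<close>
      using AE_total_count[of r] AE_clusters_count[of "r + 1"]
    proof eventually_elim
      case (elim \<omega>)
      have "contact_distance k (clusters \<omega>) \<le> ereal r \<longleftrightarrow> k \<le> card (clusters \<omega> \<inter> cball 0 r)"
        by (rule contact_distance_le_iff_card) (use r elim in auto)
      then show ?case using elim by auto
    qed
  qed measurable
  also have "\<dots> = 1 - prob {\<omega> \<in> space M. total_count r \<omega> < k}"
    by (rule prob_neg) measurable
  also have "prob {\<omega> \<in> space M. total_count r \<omega> < k} = (\<Sum>m<k. prob {\<omega> \<in> space M. total_count r \<omega> = m})"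
  proof -
    have "{\<omega> \<in> space M. total_count r \<omega> < k} = (\<Union>m<k. {\<omega> \<in> space M. total_count r \<omega> = m})" by auto
    then show ?thesis
      by (simp only:) (rule finite_measure_finite_Union, auto simp: disjoint_family_on_def)
  qed
  finally show ?thesis
    unfolding prob_total_count[OF r] h_def by (simp only: sum_distrib_left)
qed

end

theorem theorem2:
  fixes M :: "'w measure" and \<Phi> :: "'w \<Rightarrow> (real^'n) set"
    and lp ld rd r :: real and k :: nat
  assumes "prob_space M"
    and "lp > 0" and "ld > 0" and "rd > 0"
    and "prob_space.matern_cluster_process M lp ld rd \<Phi>"
    and "k \<ge> 1" and "r > 0"
  defines "h \<equiv> h_fun TYPE('n) lp ld rd"
  shows "\<P>(\<omega> in M. contact_distance k (\<Phi> \<omega>) \<le> ereal r) =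
    1 - exp (h 0 r - lp * unit_ball_vol (real CARD('n)) * (r + rd) ^ CARD('n)) *
      (\<Sum>m<k. \<Sum>b\<in>B_tuples m. (\<Prod>i=1..m. h i r ^ b i) / (\<Prod>i=1..m. fact (b i)))"
proof -
  interpret prob_space M by fact
  from assms(5) obtain P :: "'w \<Rightarrow> (real^'n) set" and X :: "nat \<Rightarrow> 'w \<Rightarrow> real^'n" and D :: "nat \<Rightarrow> 'w \<Rightarrow> (real^'n) set"
    where PXD: "poisson_process (\<lambda>_. lp) P" "\<forall>i. random_variable borel (X i)"
      "AE \<omega> in M. bij_betw (\<lambda>i. X i \<omega>) UNIV (P \<omega>)"
      "\<forall>i. poisson_process (\<lambda>y. ld * indicator {y. norm y \<le> rd} y) (D i)"
      "indep_vars (\<lambda>_. config_space) D UNIV"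
      "indep_set
          (sets (vimage_algebra (space M) (\<lambda>\<omega> i. X i \<omega>) (PiM UNIV (\<lambda>_. borel))))
          (sets (vimage_algebra (space M) (\<lambda>\<omega> i. D i \<omega>) (PiM UNIV (\<lambda>_. config_space))))"
      and \<Phi>: "\<forall>\<omega>\<in>space M. \<Phi> \<omega> = (\<Union>i. (\<lambda>y. X i \<omega> + y) ` D i \<omega>)"
    unfolding matern_cluster_process_def by (elim exE conjE) (rule that)
  interpret matern_clusters M P X D lp ld rd
    by (intro matern_clusters.intro matern_clusters_axioms.intro assms(1-4) PXD PXD(2,4)[THEN spec])
  have "{\<omega> \<in> space M. contact_distance k (\<Phi> \<omega>) \<le> ereal r} =
      {\<omega> \<in> space M. contact_distance k (clusters \<omega>) \<le> ereal r}"
    using \<Phi> unfolding clusters_def by auto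
  then show ?thesis
    unfolding h_def using prob_contact_distance_le[OF \<open>r > 0\<close>] by simp
qed

end
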